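(* The association sending an arrow algebra $\mathcal A$ to its arrow tripos $P_{\mathcal A}$ and an implicative morphism $f:\mathcal A\to\mathcal B$ to the transformation $\Phi_f^+:P_{\mathcal A}\to P_{\mathcal B}$, $(\Phi_f^+)_I(\phi)=f\circ\phi$, determines a $2$-fully faithful $2$-functor $\mathsf{ArrAlg}\hookrightarrow\mathsf{Trip}_{\mathsf{cart}}(\mathsf{Set})$. Explicitly, for all arrow algebras $\mathcal A$ and $\mathcal B$ it gives an equivalence of preorder categories $$\mathsf{ArrAlg}(\mathcal A,\mathcal B)\simeq\mathsf{Trip}_{\mathsf{cart}}(\mathsf{Set})(P_{\mathcal A},P_{\mathcal B}).$$
   Context: An arrow algebra $\mathcal A=(A,\preccurlyeq,\to,S)$ consists of a poset $(A,\preccurlyeq)$ with all meets $\bigwedge$; a binary operation $\to$ on $A$ (bracketed to the right), antitone in the first and monotone in the second argument; and a subset $S\subseteq A$ (the separator) which is upward closed, closed under modus ponens ($a\to b\in S$ and $a\in S$ imply $b\in S$), and contains the combinators $\mathbf k=\bigwedge_{a,b}a\to b\to a$, $\mathbf s=\bigwedge_{a,b,c}(a\to b\to c)\to(a\to b)\to a\to c$, and $\mathbf a=\bigwedge_{a,(b_i)_{i\in I},(c_i)_{i\in I}}\big(\bigwedge_{i\in I}a\to b_i\to c_i\big)\to a\to\bigwedge_{i\in I}(b_i\to c_i)$. An implicative morphism $f:\mathcal A\to\mathcal B$ is a function $f:A\to B$ such that: (i) $f(a)\in S_B$ for every $a\in S_A$; (ii) there is $r\in S_B$ with $r\preccurlyeq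 f(a\to a')\to f(a)\to f(a')$ for all $a,a'\in A$; (iii) for every $X\subseteq A\times A$, if $\bigwedge_{(a,a')\in X}a\to a'\in S_A$ then $\bigwedge_{(a,a')\in X}f(a)\to f(a')\in S_B$. Write $f\vdash f'$ if $\bigwedge_{a\in A}f(a)\to f'(a)\in S_B$. $\mathsf{ArrAlg}$ is the resulting preorder-enriched category of arrow algebras and implicative morphisms. A Heyting prealgebra is a preorder whose poset reflection is a Heyting algebra; $\mathsf{HeytPre}$ is the category of these with monotone maps inducing Heyting algebra morphisms on poset reflections. A tripos is a pseudofunctor $P:\mathsf{Set}^{\mathrm{op}}\to\mathsf{HeytPre}$ such that each $f^*=P(f)$ has a left adjoint $\exists_f$ and a right adjoint $\forall_f$ as monotone maps, satisfying the Beck–Chevalley condition, and such that there is a generic element $\sigma\in P(\Sigma)$ for some set $\Sigma$ (every $\phi\in P(X)$ is isomorphic to $g^*\sigma$ for some $g:X\to\Sigma$). A transformation $\Phi:P\to Q$ is a family of monotone maps $\Phi_X:P(X)\to Q(X)$, pseudonatural in $X$; $\Phi\le\Psi$ means $\Phi_X\le\Psi_X$ pointwise for all sets $X$. It is cartesian if every $\Phi_X$ preserves finite meets up to isomorphism. $\mathsf{Trip}_{\mathsf{cart}}(\mathsf{Set})$ is the preorder-enriched category of triposes and cartesian transformations. The arrow tripos $P_{\mathcal A}$ has $P_{\mathcal A}(I)=(A^I,\vdash_I)$ with $\phi\vdash_I\psi$ iff $\bigwedge_{i\in I}\phi(i)\to\psi(i)\in S$, and reindexing by precomposition. A $2$-functor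 is $2$-fully faithful if it induces equivalences of preorders on hom-preorders (order-preserving, order-reflecting and essentially surjective). *)

theory Defs
  imports "HOL-Algebra.Lattice" "HOL-Library.FuncSet"
begin

section \<open>The category of sets\<close>

text \<open>
  HOL has no type of all sets, so the category Set is given by a collection \<open>\<U>\<close> of (small) sets
  over an arbitrary type: its objects are the members of \<open>\<U>\<close>, its maps \<open>X \<rightarrow> Y\<close> the elements of
  \<open>X \<rightarrow>\<^sub>E Y\<close>, i.e. the functions made undefined outside \<open>X\<close>, so that equality of maps is
  equality on \<open>X\<close>.  Only closure under subsets and finite products (up to bijection) is required.
  In particular \<open>\<U>\<close> may be the collection of all sets of a model of set theory, any Grothendieck
  universe, or all subsets of an infinite type (see \<open>set_universe_UNIV\<close> below).
\<close>

locale set_universe =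
  fixes \<U> :: "'u set set"
  assumes subset_closed: "\<lbrakk>X \<in> \<U>; Y \<subseteq> X\<rbrakk> \<Longrightarrow> Y \<in> \<U>"
    and times_closed: "\<lbrakk>X \<in> \<U>; Y \<in> \<U>\<rbrakk> \<Longrightarrow> \<exists>Z\<in>\<U>. \<exists>h. bij_betw h (X \<times> Y) Z"
    and nontrivial: "\<exists>X\<in>\<U>. X \<noteq> {}"

lemma set_universe_UNIV:
  assumes "infinite (UNIV :: 'u set)"
  shows "set_universe (UNIV :: 'u set set)"
proof
  fix X Y :: "'u set"
  obtain p :: "'u \<times> 'u \<Rightarrow> 'u" where "inj p"
    using card_of_Times_same_infinite[OF assms]
    by (metis UNIV_Times_UNIV bij_betw_imp_inj_on card_of_ordIso)
  then have "bij_betw p (X \<times> Y) (p ` (X \<times> Y))"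
    by (meson bij_betw_imageI inj_on_subset subset_UNIV)
  then show "\<exists>Z\<in>(UNIV :: 'u set set). \<exists>h. bij_betw h (X \<times> Y) Z" by blast
qed auto

text \<open>A commuting square \<open>f \<circ> p = g \<circ> q\<close>, with \<open>p : W \<rightarrow> X\<close>, \<open>q : W \<rightarrow> Y\<close>, \<open>f : X \<rightarrow> Z\<close> and
  \<open>g : Y \<rightarrow> Z\<close>, is a pullback iff it exhibits \<open>W\<close> as the fibre product of \<open>X\<close> and \<open>Y\<close>.\<close>

definition set_pullback ::
  "'u set \<Rightarrow> 'u set \<Rightarrow> 'u set \<Rightarrow> 'u set \<Rightarrow>
   ('u \<Rightarrow> 'u) \<Rightarrow> ('u \<Rightarrow> 'u) \<Rightarrow> ('u \<Rightarrow> 'u) \<Rightarrow> ('u \<Rightarrow> 'u) \<Rightarrow> bool" where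
  "set_pullback W X Y Z p q f g \<longleftrightarrow>
     p \<in> W \<rightarrow>\<^sub>E X \<and> q \<in> W \<rightarrow>\<^sub>E Y \<and> f \<in> X \<rightarrow>\<^sub>E Z \<and> g \<in> Y \<rightarrow>\<^sub>E Z \<and>
     bij_betw (\<lambda>w. (p w, q w)) W {(x, y) \<in> X \<times> Y. f x = g y}"


section \<open>Preorder-enriched categories\<close>

definition preorder_equivalence ::
  "'m set \<Rightarrow> ('m \<Rightarrow> 'm \<Rightarrow> bool) \<Rightarrow> 'n set \<Rightarrow> ('n \<Rightarrow> 'n \<Rightarrow> bool) \<Rightarrow> ('m \<Rightarrow> 'n) \<Rightarrow> bool" where
  "preorder_equivalence H r K s F \<longleftrightarrow>
     F \<in> H \<rightarrow> K \<and>
     (\<forall>x\<in>H. \<forall>y\<in>H. r x y \<longrightarrow> s (F x) (F y)) \<and>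
     (\<forall>x\<in>H. \<forall>y\<in>H. s (F x) (F y) \<longrightarrow> r x y) \<and>
     (\<forall>z\<in>K. \<exists>x\<in>H. s (F x) z \<and> s z (F x))"

text \<open>\<open>Comp C a b c g f\<close> is the composite of \<open>f : a \<rightarrow> b\<close> followed by \<open>g : b \<rightarrow> c\<close>.\<close>

record ('o, 'm) pcat =
  Ob :: "'o set"
  Hom :: "'o \<Rightarrow> 'o \<Rightarrow> 'm set"
  Hle :: "'o \<Rightarrow> 'o \<Rightarrow> 'm \<Rightarrow> 'm \<Rightarrow> bool"
  Idm :: "'o \<Rightarrow> 'm"
  Comp :: "'o \<Rightarrow> 'o \<Rightarrow> 'o \<Rightarrow> 'm \<Rightarrow> 'm \<Rightarrow> 'm"

locale preorder_enriched_category =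
  fixes C :: "('o, 'm) pcat"
  assumes id_in_hom: "a \<in> Ob C \<Longrightarrow> Idm C a \<in> Hom C a a"
    and comp_in_hom:
      "\<lbrakk>a \<in> Ob C; b \<in> Ob C; c \<in> Ob C; f \<in> Hom C a b; g \<in> Hom C b c\<rbrakk>
       \<Longrightarrow> Comp C a b c g f \<in> Hom C a c"
    and comp_id_right: "\<lbrakk>a \<in> Ob C; b \<in> Ob C; f \<in> Hom C a b\<rbrakk> \<Longrightarrow> Comp C a a b f (Idm C a) = f"
    and comp_id_left: "\<lbrakk>a \<in> Ob C; b \<in> Ob C; f \<in> Hom C a b\<rbrakk> \<Longrightarrow> Comp C a b b (Idm C b) f = f"
    and comp_assoc:
      "\<lbrakk>a \<in> Ob C; b \<in> Ob C; c \<in> Ob C; d \<in> Ob C;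
        f \<in> Hom C a b; g \<in> Hom C b c; h \<in> Hom C c d\<rbrakk>
       \<Longrightarrow> Comp C a b d (Comp C b c d h g) f = Comp C a c d h (Comp C a b c g f)"
    and hle_refl: "\<lbrakk>a \<in> Ob C; b \<in> Ob C; f \<in> Hom C a b\<rbrakk> \<Longrightarrow> Hle C a b f f"
    and hle_trans:
      "\<lbrakk>a \<in> Ob C; b \<in> Ob C; f \<in> Hom C a b; g \<in> Hom C a b; h \<in> Hom C a b;
        Hle C a b f g; Hle C a b g h\<rbrakk> \<Longrightarrow> Hle C a b f h"
    and comp_mono:
      "\<lbrakk>a \<in> Ob C; b \<in> Ob C; c \<in> Ob C;
        f \<in> Hom C a b; f' \<in> Hom C a b; g \<in> Hom C b c; g' \<in> Hom C b c;
        Hle C a b f f'; Hle C b c g g'\<rbrakk>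
       \<Longrightarrow> Hle C a c (Comp C a b c g f) (Comp C a b c g' f')"

locale two_functor =
  dom: preorder_enriched_category C + cod: preorder_enriched_category D
  for C :: "('o, 'm) pcat" and D :: "('p, 'n) pcat" +
  fixes F\<^sub>0 :: "'o \<Rightarrow> 'p" and F\<^sub>1 :: "'o \<Rightarrow> 'o \<Rightarrow> 'm \<Rightarrow> 'n"
  assumes map_ob: "a \<in> Ob C \<Longrightarrow> F\<^sub>0 a \<in> Ob D"
    and map_hom:
      "\<lbrakk>a \<in> Ob C; b \<in> Ob C; f \<in> Hom C a b\<rbrakk> \<Longrightarrow> F\<^sub>1 a b f \<in> Hom D (F\<^sub>0 a) (F\<^sub>0 b)"
    and map_id: "a \<in> Ob C \<Longrightarrow> F\<^sub>1 a a (Idm C a) = Idm D (F\<^sub>0 a)"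
    and map_comp:
      "\<lbrakk>a \<in> Ob C; b \<in> Ob C; c \<in> Ob C; f \<in> Hom C a b; g \<in> Hom C b c\<rbrakk>
       \<Longrightarrow> F\<^sub>1 a c (Comp C a b c g f) = Comp D (F\<^sub>0 a) (F\<^sub>0 b) (F\<^sub>0 c) (F\<^sub>1 b c g) (F\<^sub>1 a b f)"
    and map_hle:
      "\<lbrakk>a \<in> Ob C; b \<in> Ob C; f \<in> Hom C a b; f' \<in> Hom C a b; Hle C a b f f'\<rbrakk>
       \<Longrightarrow> Hle D (F\<^sub>0 a) (F\<^sub>0 b) (F\<^sub>1 a b f) (F\<^sub>1 a b f')"

locale two_fully_faithful_functor = two_functor +
  assumes hom_equivalence:
    "\<lbrakk>a \<in> Ob C; b \<in> Ob C\<rbrakk> \<Longrightarrow>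
     preorder_equivalence (Hom C a b) (Hle C a b)
       (Hom D (F\<^sub>0 a) (F\<^sub>0 b)) (Hle D (F\<^sub>0 a) (F\<^sub>0 b)) (F\<^sub>1 a b)"


section \<open>Arrow algebras and implicative morphisms\<close>

record 'a arrow_structure = "'a gorder" +
  arr :: "'a \<Rightarrow> 'a \<Rightarrow> 'a" (infixr \<open>\<leadsto>\<index>\<close> 60)
  separator :: "'a set"

text \<open>In the combinator \<open>a\<close> a pair of families \<open>(b\<^sub>i)\<^sub>i\<close>, \<open>(c\<^sub>i)\<^sub>i\<close> with a common index set enters
  only through the set \<open>X\<close> of all pairs \<open>(b\<^sub>i, c\<^sub>i)\<close>, and every set of pairs arises in this way.\<close>

locale arrow_algebra = partial_order A for A :: "'a arrow_structure" (structure) +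
  assumes meets: "X \<subseteq> carrier A \<Longrightarrow> \<exists>m. greatest A m (Lower A X)"
    and arr_closed: "\<lbrakk>a \<in> carrier A; b \<in> carrier A\<rbrakk> \<Longrightarrow> a \<leadsto> b \<in> carrier A"
    and arr_antitone:
      "\<lbrakk>a \<in> carrier A; a' \<in> carrier A; b \<in> carrier A; a' \<sqsubseteq> a\<rbrakk> \<Longrightarrow> (a \<leadsto> b) \<sqsubseteq> (a' \<leadsto> b)"
    and arr_monotone:
      "\<lbrakk>a \<in> carrier A; b \<in> carrier A; b' \<in> carrier A; b \<sqsubseteq> b'\<rbrakk> \<Longrightarrow> (a \<leadsto> b) \<sqsubseteq> (a \<leadsto> b')"
    and separator_subset: "separator A \<subseteq> carrier A"
    and separator_upward: "\<lbrakk>a \<in> separator A; b \<in> carrier A; a \<sqsubseteq> b\<rbrakk> \<Longrightarrow> b \<in> separator A"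
    and modus_ponens:
      "\<lbrakk>a \<in> carrier A; b \<in> carrier A; a \<leadsto> b \<in> separator A; a \<in> separator A\<rbrakk>
       \<Longrightarrow> b \<in> separator A"
    and combinator_k: "\<Sqinter>{a \<leadsto> b \<leadsto> a | a b. a \<in> carrier A \<and> b \<in> carrier A} \<in> separator A"
    and combinator_s:
      "\<Sqinter>{(a \<leadsto> b \<leadsto> c) \<leadsto> (a \<leadsto> b) \<leadsto> a \<leadsto> c | a b c.
          a \<in> carrier A \<and> b \<in> carrier A \<and> c \<in> carrier A} \<in> separator A"
    and combinator_a:
      "\<Sqinter>{\<Sqinter>{a \<leadsto> b \<leadsto> c | b c. (b, c) \<in> X} \<leadsto> a \<leadsto> \<Sqinter>{b \<leadsto> c | b c. (b, c) \<in> X} | a X.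
          a \<in> carrier A \<and> X \<subseteq> carrier A \<times> carrier A} \<in> separator A"

definition implicative_morphism ::
  "'a arrow_structure \<Rightarrow> 'b arrow_structure \<Rightarrow> ('a \<Rightarrow> 'b) \<Rightarrow> bool" where
  "implicative_morphism A B f \<longleftrightarrow>
     f \<in> carrier A \<rightarrow> carrier B \<and>
     (\<forall>a\<in>separator A. f a \<in> separator B) \<and>
     (\<exists>r\<in>separator B. \<forall>a\<in>carrier A. \<forall>a'\<in>carrier A.
        r \<sqsubseteq>\<^bsub>B\<^esub> (f (a \<leadsto>\<^bsub>A\<^esub> a') \<leadsto>\<^bsub>B\<^esub> f a \<leadsto>\<^bsub>B\<^esub> f a')) \<and>
     (\<forall>X. X \<subseteq> carrier A \<times> carrier A \<longrightarrow>
        \<Sqinter>\<^bsub>A\<^esub>{a \<leadsto>\<^bsub>A\<^esub> a' | a a'. (a, a') \<in> X} \<in> separator A \<longrightarrow>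
        \<Sqinter>\<^bsub>B\<^esub>{f a \<leadsto>\<^bsub>B\<^esub> f a' | a a'. (a, a') \<in> X} \<in> separator B)"

text \<open>\<open>entails B I \<phi> \<psi>\<close> is \<open>\<phi> \<turnstile>\<^sub>I \<psi>\<close>: the order of the fibre over \<open>I\<close> of the arrow tripos of \<open>B\<close>,
  and for \<open>I = carrier A\<close> the order on implicative morphisms from \<open>A\<close> to \<open>B\<close>.\<close>

definition entails ::
  "'b arrow_structure \<Rightarrow> 'i set \<Rightarrow> ('i \<Rightarrow> 'b) \<Rightarrow> ('i \<Rightarrow> 'b) \<Rightarrow> bool" where
  "entails B I \<phi> \<psi> \<longleftrightarrow> \<Sqinter>\<^bsub>B\<^esub>{\<phi> i \<leadsto>\<^bsub>B\<^esub> \<psi> i | i. i \<in> I} \<in> separator B"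

definition ArrAlg :: "'u set set \<Rightarrow> ('u arrow_structure, 'u \<Rightarrow> 'u) pcat" where
  "ArrAlg \<U> =
     \<lparr>Ob = {A. arrow_algebra A \<and> carrier A \<in> \<U>},
      Hom = (\<lambda>A B. {f \<in> carrier A \<rightarrow>\<^sub>E carrier B. implicative_morphism A B f}),
      Hle = (\<lambda>A B. entails B (carrier A)),
      Idm = (\<lambda>A. \<lambda>a\<in>carrier A. a),
      Comp = (\<lambda>A B C g f. compose (carrier A) g f)\<rparr>"


section \<open>Heyting prealgebras\<close>

text \<open>A preorder is represented as a \<^locale>\<open>weak_partial_order\<close>, whose equality \<open>.=\<close> is then
  necessarily the isomorphism relation of the preorder.\<close>

definition poset_reflection :: "'a gorder \<Rightarrow> 'a set gorder" where
  "poset_reflection L =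
     \<lparr>carrier = classes\<^bsub>L\<^esub>, eq = (=), le = (\<lambda>K M. \<exists>x\<in>K. \<exists>y\<in>M. x \<sqsubseteq>\<^bsub>L\<^esub> y)\<rparr>"

definition reflected_map :: "'a gorder \<Rightarrow> 'b gorder \<Rightarrow> ('a \<Rightarrow> 'b) \<Rightarrow> 'a set \<Rightarrow> 'b set" where
  "reflected_map L M h K = {y \<in> carrier M. \<exists>x\<in>K. h x .=\<^bsub>M\<^esub> y}"

definition is_heyting_imp :: "'a gorder \<Rightarrow> 'a \<Rightarrow> 'a \<Rightarrow> 'a \<Rightarrow> bool" where
  "is_heyting_imp L a b c \<longleftrightarrow> greatest L c {x \<in> carrier L. (x \<sqinter>\<^bsub>L\<^esub> a) \<sqsubseteq>\<^bsub>L\<^esub> b}"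

locale heyting_algebra = bounded_lattice L for L :: "'a gorder" (structure) +
  assumes heyting_imp_exists:
    "\<lbrakk>a \<in> carrier L; b \<in> carrier L\<rbrakk> \<Longrightarrow> \<exists>c. is_heyting_imp L a b c"

definition heyting_hom :: "'a gorder \<Rightarrow> 'b gorder \<Rightarrow> ('a \<Rightarrow> 'b) \<Rightarrow> bool" where
  "heyting_hom L M h \<longleftrightarrow>
     h \<in> carrier L \<rightarrow> carrier M \<and> h \<top>\<^bsub>L\<^esub> = \<top>\<^bsub>M\<^esub> \<and> h \<bottom>\<^bsub>L\<^esub> = \<bottom>\<^bsub>M\<^esub> \<and>
     meet_pres L M h \<and> join_pres L M h \<and>
     (\<forall>a\<in>carrier L. \<forall>b\<in>carrier L. \<forall>c\<in>carrier L.
        is_heyting_imp L a b c \<longrightarrow> is_heyting_imp M (h a) (h b) (h c))"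

definition heyting_prealgebra :: "'a gorder \<Rightarrow> bool" where
  "heyting_prealgebra L \<longleftrightarrow> weak_partial_order L \<and> heyting_algebra (poset_reflection L)"

definition monotone_map :: "'a gorder \<Rightarrow> 'b gorder \<Rightarrow> ('a \<Rightarrow> 'b) \<Rightarrow> bool" where
  "monotone_map L M h \<longleftrightarrow> h \<in> carrier L \<rightarrow> carrier M \<and> isotone L M h"

definition heyting_premorphism :: "'a gorder \<Rightarrow> 'b gorder \<Rightarrow> ('a \<Rightarrow> 'b) \<Rightarrow> bool" where
  "heyting_premorphism L M h \<longleftrightarrow>
     monotone_map L M h \<and>
     heyting_hom (poset_reflection L) (poset_reflection M) (reflected_map L M h)"

text \<open>\<open>l : L \<rightarrow> M\<close> is left adjoint to \<open>r : M \<rightarrow> L\<close>.\<close>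

definition adjoint_maps :: "'a gorder \<Rightarrow> 'b gorder \<Rightarrow> ('a \<Rightarrow> 'b) \<Rightarrow> ('b \<Rightarrow> 'a) \<Rightarrow> bool" where
  "adjoint_maps L M l r \<longleftrightarrow>
     monotone_map L M l \<and> monotone_map M L r \<and>
     (\<forall>x\<in>carrier L. \<forall>y\<in>carrier M. l x \<sqsubseteq>\<^bsub>M\<^esub> y \<longleftrightarrow> x \<sqsubseteq>\<^bsub>L\<^esub> r y)"


section \<open>Triposes and cartesian transformations\<close>

text \<open>\<open>reindex P X Y f : P(Y) \<rightarrow> P(X)\<close> is reindexing along \<open>f : X \<rightarrow> Y\<close>.\<close>

record ('u, 'p) indexed_preorder =
  fibre :: "'u set \<Rightarrow> 'p gorder"
  reindex :: "'u set \<Rightarrow> 'u set \<Rightarrow> ('u \<Rightarrow> 'u) \<Rightarrow> 'p \<Rightarrow> 'p"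

text \<open>A pseudofunctor into a preorder-enriched category preserves identities and composition up to
  isomorphism, with no coherence condition.  Adjoints being unique up to isomorphism, the
  Beck--Chevalley condition is stated for an arbitrary choice of them.\<close>

locale tripos =
  fixes \<U> :: "'u set set" and P :: "('u, 'p) indexed_preorder"
  assumes fibre_heyting: "X \<in> \<U> \<Longrightarrow> heyting_prealgebra (fibre P X)"
    and reindex_heyting:
      "\<lbrakk>X \<in> \<U>; Y \<in> \<U>; f \<in> X \<rightarrow>\<^sub>E Y\<rbrakk>
       \<Longrightarrow> heyting_premorphism (fibre P Y) (fibre P X) (reindex P X Y f)"
    and reindex_id:
      "\<lbrakk>X \<in> \<U>; \<phi> \<in> carrier (fibre P X)\<rbrakk>
       \<Longrightarrow> reindex P X X (\<lambda>x\<in>X. x) \<phi> .=\<^bsub>fibre P X\<^esub> \<phi>"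
    and reindex_comp:
      "\<lbrakk>X \<in> \<U>; Y \<in> \<U>; Z \<in> \<U>; f \<in> X \<rightarrow>\<^sub>E Y; g \<in> Y \<rightarrow>\<^sub>E Z; \<phi> \<in> carrier (fibre P Z)\<rbrakk>
       \<Longrightarrow> reindex P X Z (compose X g f) \<phi> .=\<^bsub>fibre P X\<^esub> reindex P X Y f (reindex P Y Z g \<phi>)"
    and ex_left_adjoint:
      "\<lbrakk>X \<in> \<U>; Y \<in> \<U>; f \<in> X \<rightarrow>\<^sub>E Y\<rbrakk>
       \<Longrightarrow> \<exists>E. adjoint_maps (fibre P X) (fibre P Y) E (reindex P X Y f)"
    and ex_right_adjoint:
      "\<lbrakk>X \<in> \<U>; Y \<in> \<U>; f \<in> X \<rightarrow>\<^sub>E Y\<rbrakk>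
       \<Longrightarrow> \<exists>U. adjoint_maps (fibre P Y) (fibre P X) (reindex P X Y f) U"
    and beck_chevalley_left:
      "\<lbrakk>W \<in> \<U>; X \<in> \<U>; Y \<in> \<U>; Z \<in> \<U>; set_pullback W X Y Z p q f g;
        adjoint_maps (fibre P X) (fibre P Z) E\<^sub>f (reindex P X Z f);
        adjoint_maps (fibre P W) (fibre P Y) E\<^sub>q (reindex P W Y q);
        \<phi> \<in> carrier (fibre P X)\<rbrakk>
       \<Longrightarrow> reindex P Y Z g (E\<^sub>f \<phi>) .=\<^bsub>fibre P Y\<^esub> E\<^sub>q (reindex P W X p \<phi>)"
    and beck_chevalley_right:
      "\<lbrakk>W \<in> \<U>; X \<in> \<U>; Y \<in> \<U>; Z \<in> \<U>; set_pullback W X Y Z p q f g;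
        adjoint_maps (fibre P Z) (fibre P X) (reindex P X Z f) U\<^sub>f;
        adjoint_maps (fibre P Y) (fibre P W) (reindex P W Y q) U\<^sub>q;
        \<phi> \<in> carrier (fibre P X)\<rbrakk>
       \<Longrightarrow> reindex P Y Z g (U\<^sub>f \<phi>) .=\<^bsub>fibre P Y\<^esub> U\<^sub>q (reindex P W X p \<phi>)"
    and generic_element:
      "\<exists>\<Sigma>\<in>\<U>. \<exists>\<sigma>\<in>carrier (fibre P \<Sigma>). \<forall>X\<in>\<U>. \<forall>\<phi>\<in>carrier (fibre P X).
         \<exists>g\<in>X \<rightarrow>\<^sub>E \<Sigma>. \<phi> .=\<^bsub>fibre P X\<^esub> reindex P X \<Sigma> g \<sigma>"

definition transformation ::
  "'u set set \<Rightarrow> ('u, 'p) indexed_preorder \<Rightarrow> ('u, 'q) indexed_preorder \<Rightarrow>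
   ('u set \<Rightarrow> 'p \<Rightarrow> 'q) \<Rightarrow> bool" where
  "transformation \<U> P Q \<Phi> \<longleftrightarrow>
     (\<forall>X\<in>\<U>. monotone_map (fibre P X) (fibre Q X) (\<Phi> X)) \<and>
     (\<forall>X\<in>\<U>. \<forall>Y\<in>\<U>. \<forall>f\<in>X \<rightarrow>\<^sub>E Y. \<forall>\<phi>\<in>carrier (fibre P Y).
        \<Phi> X (reindex P X Y f \<phi>) .=\<^bsub>fibre Q X\<^esub> reindex Q X Y f (\<Phi> Y \<phi>))"

text \<open>\<open>greatest L m (Lower L F)\<close> says that \<open>m\<close> is a meet of \<open>F\<close>, determined up to isomorphism.\<close>

definition preserves_finite_meets :: "'a gorder \<Rightarrow> 'b gorder \<Rightarrow> ('a \<Rightarrow> 'b) \<Rightarrow> bool" where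
  "preserves_finite_meets L M h \<longleftrightarrow>
     (\<forall>F m. finite F \<longrightarrow> F \<subseteq> carrier L \<longrightarrow>
        greatest L m (Lower L F) \<longrightarrow> greatest M (h m) (Lower M (h ` F)))"

definition cartesian_transformation ::
  "'u set set \<Rightarrow> ('u, 'p) indexed_preorder \<Rightarrow> ('u, 'q) indexed_preorder \<Rightarrow>
   ('u set \<Rightarrow> 'p \<Rightarrow> 'q) \<Rightarrow> bool" where
  "cartesian_transformation \<U> P Q \<Phi> \<longleftrightarrow>
     transformation \<U> P Q \<Phi> \<and>
     (\<forall>X\<in>\<U>. preserves_finite_meets (fibre P X) (fibre Q X) (\<Phi> X))"

definition Trip_cart ::
  "'u set set \<Rightarrow> (('u, 'p) indexed_preorder, 'u set \<Rightarrow> 'p \<Rightarrow> 'p) pcat" where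
  "Trip_cart \<U> =
     \<lparr>Ob = {P. tripos \<U> P},
      Hom = (\<lambda>P Q. {\<Phi> \<in> \<Pi>\<^sub>E X\<in>\<U>. carrier (fibre P X) \<rightarrow>\<^sub>E carrier (fibre Q X).
                      cartesian_transformation \<U> P Q \<Phi>}),
      Hle = (\<lambda>P Q \<Phi> \<Psi>. \<forall>X\<in>\<U>. \<forall>\<phi>\<in>carrier (fibre P X). \<Phi> X \<phi> \<sqsubseteq>\<^bsub>fibre Q X\<^esub> \<Psi> X \<phi>),
      Idm = (\<lambda>P. \<lambda>X\<in>\<U>. \<lambda>\<phi>\<in>carrier (fibre P X). \<phi>),
      Comp = (\<lambda>P Q R \<Psi> \<Phi>. \<lambda>X\<in>\<U>. compose (carrier (fibre P X)) (\<Psi> X) (\<Phi> X))\<rparr>"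


section \<open>Arrow triposes\<close>

definition arrow_tripos :: "'u arrow_structure \<Rightarrow> ('u, 'u \<Rightarrow> 'u) indexed_preorder" where
  "arrow_tripos A =
     \<lparr>fibre = (\<lambda>I.
        \<lparr>carrier = I \<rightarrow>\<^sub>E carrier A,
         eq = (\<lambda>\<phi> \<psi>. entails A I \<phi> \<psi> \<and> entails A I \<psi> \<phi>),
         le = entails A I\<rparr>),
      reindex = (\<lambda>I J f \<phi>. compose I \<phi> f)\<rparr>"

definition arrow_transformation ::
  "'u set set \<Rightarrow> 'u arrow_structure \<Rightarrow> 'u arrow_structure \<Rightarrow> ('u \<Rightarrow> 'u) \<Rightarrow>
   'u set \<Rightarrow> ('u \<Rightarrow> 'u) \<Rightarrow> 'u \<Rightarrow> 'u" where
  "arrow_transformation \<U> A B f = (\<lambda>I\<in>\<U>. \<lambda>\<phi>\<in>I \<rightarrow>\<^sub>E carrier A. compose I f \<phi>)"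

end

theory Submission
  imports Defs "HOL-Algebra.Complete_Lattice"
begin

text \<open>
  A family of elements of an arrow algebra indexed by a set \<open>I\<close> is read as a formula with a
  parameter in \<open>I\<close>; it is valid if the meet of its values lies in the separator, and \<open>\<phi> \<turnstile>\<^sub>I \<psi>\<close> says
  that \<open>\<phi> \<leadsto> \<psi>\<close> is valid.  A separator is closed under modus ponens one element at a time, and for
  families the rule can be relied on only if the conclusion is itself an implication: this is what
  the combinator \<open>a\<close> provides (\<open>valid_mp\<close>).  Entailments are such conclusions, so this restricted
  rule and the combinators \<open>k\<close> and \<open>s\<close> suffice for intuitionistic implicational logic over every
  \<open>I\<close>.  The combinator \<open>a\<close> also makes meets of implications behave as universal quantifiers
  (\<open>entails_inf_imp_iff\<close>), and then conjunction, disjunction and both quantifiers are available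
  through their second-order encodings.
  
  All of these operations act pointwise on families, so reindexing preserves the Heyting structure
  on the nose.  The adjoints of reindexing along \<open>f\<close> quantify over the fibres of \<open>f\<close>, and a pullback
  square has the same fibres on both of its sides, which is the Beck--Chevalley condition; the
  identity of the carrier is a generic element.  Hence \<open>P\<^sub>A\<close> is a tripos (\<open>tripos_arrow_tripos\<close>).
  
  An implicative morphism \<open>f\<close> acts by \<open>\<phi> \<mapsto> f \<circ> \<phi>\<close>.  Its third property says that this is monotone,
  the first that the top element is preserved, and the second, applied to the entailment
  \<open>a \<turnstile> b \<leadsto> a \<and> b\<close>, gives \<open>f a \<and> f b \<turnstile> f (a \<and> b)\<close>.  Conversely, each \<open>\<phi> : I \<rightarrow> A\<close> is the reindexing along
  \<open>\<phi>\<close> of the identity of the carrier, so a transformation \<open>\<Phi>\<close> is determined up to isomorphism by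
  \<open>f = \<Phi>(id)\<close>: naturality gives \<open>\<Phi> \<phi> \<simeq> f \<circ> \<phi>\<close>.  Each property of an implicative morphism holds for
  \<open>f\<close> because \<open>\<Phi>\<close> preserves one entailment over a suitable index set: a valid constant over a
  point, \<open>(a \<leadsto> a') \<and> a \<turnstile> a'\<close> over all pairs \<open>(a, a')\<close>, and the given \<open>a \<turnstile> a'\<close> over a set of pairs.
  Finally \<open>f \<turnstile> f'\<close> is the component at the identity of the inequality of transformations, and it
  implies all the other components by reindexing.
\<close>

section \<open>Uniform validity in an arrow algebra\<close>

declare Pi_iff [simp]

sublocale arrow_algebra \<subseteq> complete_lattice A
proof (rule complete_lattice_criterion1)
  show "\<exists>g. greatest A g (carrier A)"
    using meets[of "{}"] by simp
qed (use meets in auto)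

definition valid :: "'a arrow_structure \<Rightarrow> 'i set \<Rightarrow> ('i \<Rightarrow> 'a) \<Rightarrow> bool" where
  "valid A I \<phi> \<longleftrightarrow> \<Sqinter>\<^bsub>A\<^esub>(\<phi> ` I) \<in> separator A"

lemma entails_eq_valid: "entails A I \<phi> \<psi> \<longleftrightarrow> valid A I (\<lambda>i. \<phi> i \<leadsto>\<^bsub>A\<^esub> \<psi> i)"
  by (simp add: entails_def valid_def setcompr_eq_image)

lemma valid_image: "valid A (h ` I) \<phi> \<longleftrightarrow> valid A I (\<lambda>i. \<phi> (h i))"
  by (simp add: valid_def image_image)

lemma entails_image: "entails A (h ` I) \<phi> \<psi> \<longleftrightarrow> entails A I (\<lambda>i. \<phi> (h i)) (\<lambda>i. \<psi> (h i))"
  by (simp add: entails_eq_valid valid_image)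

lemma valid_cong:
  "(\<And>i. i \<in> I \<Longrightarrow> \<phi> i = \<psi> i) \<Longrightarrow> valid A I \<phi> \<longleftrightarrow> valid A I \<psi>"
  by (simp add: valid_def cong: image_cong)

lemma entails_cong:
  "\<lbrakk>\<And>i. i \<in> I \<Longrightarrow> \<phi> i = \<phi>' i; \<And>i. i \<in> I \<Longrightarrow> \<psi> i = \<psi>' i\<rbrakk>
   \<Longrightarrow> entails A I \<phi> \<psi> \<longleftrightarrow> entails A I \<phi>' \<psi>'"
  unfolding entails_eq_valid by (rule valid_cong) simp

context arrow_algebra
begin

declare arr_closed [simp, intro]

lemma separator_closed: "a \<in> separator A \<Longrightarrow> a \<in> carrier A"
  using separator_subset by blast

lemma inf_fun_closed [simp, intro]: "\<phi> \<in> I \<rightarrow> carrier A \<Longrightarrow> \<Sqinter>(\<phi> ` I) \<in> carrier A"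
  by (rule inf_closed) auto

lemma inf_fun_lower: "\<lbrakk>\<phi> \<in> I \<rightarrow> carrier A; i \<in> I\<rbrakk> \<Longrightarrow> \<Sqinter>(\<phi> ` I) \<sqsubseteq> \<phi> i"
  by (rule inf_lower) auto

lemma inf_fun_greatest:
  "\<lbrakk>\<phi> \<in> I \<rightarrow> carrier A; a \<in> carrier A; \<And>i. i \<in> I \<Longrightarrow> a \<sqsubseteq> \<phi> i\<rbrakk> \<Longrightarrow> a \<sqsubseteq> \<Sqinter>(\<phi> ` I)"
  by (rule inf_greatest) auto

lemma valid_mono:
  assumes "valid A J \<phi>" "\<phi> \<in> J \<rightarrow> carrier A" "\<psi> \<in> I \<rightarrow> carrier A"
    and "\<And>i. i \<in> I \<Longrightarrow> \<exists>j\<in>J. \<phi> j \<sqsubseteq> \<psi> i"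
  shows "valid A I \<psi>"
proof -
  have "\<Sqinter>(\<phi> ` J) \<sqsubseteq> \<Sqinter>(\<psi> ` I)"
  proof (rule inf_fun_greatest)
    fix i assume i: "i \<in> I"
    obtain j where "j \<in> J" "\<phi> j \<sqsubseteq> \<psi> i" using assms(4)[OF i] by blast
    then show "\<Sqinter>(\<phi> ` J) \<sqsubseteq> \<psi> i"
      using assms(2,3) i inf_fun_lower[OF assms(2), of j] le_trans[of "\<Sqinter>(\<phi> ` J)" "\<phi> j" "\<psi> i"]
      by auto
  qed (use assms in auto)
  then show ?thesis
    using assms separator_upward unfolding valid_def by blast
qed

lemma valid_of_separator:
  assumes "s \<in> separator A" "\<psi> \<in> I \<rightarrow> carrier A" "\<And>i. i \<in> I \<Longrightarrow> s \<sqsubseteq> \<psi> i"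
  shows "valid A I \<psi>"
proof -
  have "s \<sqsubseteq> \<Sqinter>(\<psi> ` I)"
    using assms by (intro inf_fun_greatest) (auto simp: separator_closed)
  then show ?thesis
    using assms separator_upward unfolding valid_def by blast
qed

lemma valid_k:
  assumes "a \<in> I \<rightarrow> carrier A" "b \<in> I \<rightarrow> carrier A"
  shows "valid A I (\<lambda>i. a i \<leadsto> b i \<leadsto> a i)"
proof (rule valid_of_separator[OF combinator_k])
  fix i assume "i \<in> I"
  then show "\<Sqinter>{a \<leadsto> b \<leadsto> a | a b. a \<in> carrier A \<and> b \<in> carrier A} \<sqsubseteq> a i \<leadsto> b i \<leadsto> a i"
    using assms by (intro inf_lower) (auto, blast)
qed (use assms in auto)

lemma valid_s:
  assumes "a \<in> I \<rightarrow> carrier A" "b \<in> I \<rightarrow> carrier A" "c \<in> I \<rightarrow> carrier A"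
  shows "valid A I (\<lambda>i. (a i \<leadsto> b i \<leadsto> c i) \<leadsto> (a i \<leadsto> b i) \<leadsto> a i \<leadsto> c i)"
proof (rule valid_of_separator[OF combinator_s])
  fix i assume "i \<in> I"
  then show "\<Sqinter>{(a \<leadsto> b \<leadsto> c) \<leadsto> (a \<leadsto> b) \<leadsto> a \<leadsto> c | a b c.
      a \<in> carrier A \<and> b \<in> carrier A \<and> c \<in> carrier A} \<sqsubseteq> (a i \<leadsto> b i \<leadsto> c i) \<leadsto> (a i \<leadsto> b i) \<leadsto> a i \<leadsto> c i"
    using assms by (intro inf_lower) (auto, blast)
qed (use assms in auto)

text \<open>
  A dependent form of the combinator: the families \<open>b i\<close> and \<open>c i\<close> may have their own index set
  \<open>J i\<close> for every \<open>i\<close>, since the separator contains one element below all instances at once.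
\<close>

lemma valid_a:
  assumes "a \<in> I \<rightarrow> carrier A"
    and "\<And>i. i \<in> I \<Longrightarrow> b i \<in> J i \<rightarrow> carrier A" "\<And>i. i \<in> I \<Longrightarrow> c i \<in> J i \<rightarrow> carrier A"
  shows "valid A I (\<lambda>i. \<Sqinter>((\<lambda>j. a i \<leadsto> b i j \<leadsto> c i j) ` J i) \<leadsto> a i \<leadsto> \<Sqinter>((\<lambda>j. b i j \<leadsto> c i j) ` J i))"
proof (rule valid_of_separator[OF combinator_a])
  let ?C = "{\<Sqinter>{a \<leadsto> b \<leadsto> c | b c. (b, c) \<in> X} \<leadsto> a \<leadsto> \<Sqinter>{b \<leadsto> c | b c. (b, c) \<in> X} | a X.
          a \<in> carrier A \<and> X \<subseteq> carrier A \<times> carrier A}"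
  fix i assume i: "i \<in> I"
  have bc: "b i j \<in> carrier A" "c i j \<in> carrier A" if "j \<in> J i" for j
    using assms i that by auto
  let ?X = "(\<lambda>j. (b i j, c i j)) ` J i"
  have *: "{a i \<leadsto> b' \<leadsto> c' | b' c'. (b', c') \<in> ?X} = (\<lambda>j. a i \<leadsto> b i j \<leadsto> c i j) ` J i"
    "{b' \<leadsto> c' | b' c'. (b', c') \<in> ?X} = (\<lambda>j. b i j \<leadsto> c i j) ` J i"
    by auto
  have "?C \<subseteq> carrier A"
  proof clarify
    fix a X assume "a \<in> carrier A" "X \<subseteq> carrier A \<times> carrier A"
    then show "\<Sqinter>{a \<leadsto> b \<leadsto> c | b c. (b, c) \<in> X} \<leadsto> a \<leadsto> \<Sqinter>{b \<leadsto> c | b c. (b, c) \<in> X} \<in> carrier A"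
      by (intro arr_closed inf_closed) auto
  qed
  moreover have "\<Sqinter>((\<lambda>j. a i \<leadsto> b i j \<leadsto> c i j) ` J i) \<leadsto> a i \<leadsto> \<Sqinter>((\<lambda>j. b i j \<leadsto> c i j) ` J i) \<in> ?C"
    using assms(1) i bc by (intro CollectI exI[of _ "a i"] exI[of _ ?X]) (auto simp: *)
  ultimately show "\<Sqinter>?C \<sqsubseteq> \<Sqinter>((\<lambda>j. a i \<leadsto> b i j \<leadsto> c i j) ` J i) \<leadsto> a i \<leadsto> \<Sqinter>((\<lambda>j. b i j \<leadsto> c i j) ` J i)"
    by (rule inf_lower)
next
  show "(\<lambda>i. \<Sqinter>((\<lambda>j. a i \<leadsto> b i j \<leadsto> c i j) ` J i) \<leadsto> a i \<leadsto> \<Sqinter>((\<lambda>j. b i j \<leadsto> c i j) ` J i)) \<in> I \<rightarrow> carrier A"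
    using assms by (intro Pi_I arr_closed inf_fun_closed) (auto simp: Pi_iff)
qed

text \<open>
  Antitonicity replaces the varying hypothesis \<open>a i\<close> by the single element \<open>\<Sqinter>(a ` I)\<close> of the
  separator.  The combinator \<open>a\<close> then moves the meet over \<open>I\<close> past this constant hypothesis, and
  modus ponens for elements applies twice.  The combinator acts only on meets of implications,
  which is why the conclusion has the form \<open>b i \<leadsto> c i\<close>.
\<close>

lemma valid_mp:
  assumes "valid A I (\<lambda>i. a i \<leadsto> b i \<leadsto> c i)" "valid A I a"
    and "a \<in> I \<rightarrow> carrier A" "b \<in> I \<rightarrow> carrier A" "c \<in> I \<rightarrow> carrier A"
  shows "valid A I (\<lambda>i. b i \<leadsto> c i)"
proof -
  let ?m = "\<Sqinter>(a ` I)" and ?M = "\<Sqinter>((\<lambda>i. b i \<leadsto> c i) ` I)"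
  have m: "?m \<in> carrier A" using assms by auto
  have "valid A I (\<lambda>i. ?m \<leadsto> b i \<leadsto> c i)"
  proof (rule valid_mono[OF assms(1)])
    fix i assume "i \<in> I"
    moreover from this have "?m \<sqsubseteq> a i" using assms by (intro inf_fun_lower)
    ultimately show "\<exists>j\<in>I. a j \<leadsto> b j \<leadsto> c j \<sqsubseteq> ?m \<leadsto> b i \<leadsto> c i"
      using assms m by (intro bexI[of _ i] arr_antitone) auto
  qed (use assms m in auto)
  then have prem: "\<Sqinter>((\<lambda>i. ?m \<leadsto> b i \<leadsto> c i) ` I) \<in> separator A" by (simp add: valid_def)
  have "valid A {()} (\<lambda>_. \<Sqinter>((\<lambda>i. ?m \<leadsto> b i \<leadsto> c i) ` I) \<leadsto> ?m \<leadsto> ?M)"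
    using assms m by (intro valid_a) auto
  then have "\<Sqinter>((\<lambda>i. ?m \<leadsto> b i \<leadsto> c i) ` I) \<leadsto> ?m \<leadsto> ?M \<in> separator A"
    using assms m by (auto simp: valid_def separator_closed)
  then have "?m \<leadsto> ?M \<in> separator A"
    by (rule modus_ponens[OF _ _ _ prem, rotated 2]) (use prem assms m in \<open>auto simp: separator_closed\<close>)
  then show ?thesis
    using assms m modus_ponens[of ?m ?M] unfolding valid_def by auto
qed

lemma valid_Sigma:
  assumes "valid A (Sigma I J) \<phi>" "\<phi> \<in> Sigma I J \<rightarrow> carrier A"
  shows "valid A I (\<lambda>i. \<Sqinter>((\<lambda>j. \<phi> (i, j)) ` J i))"
proof (rule valid_of_separator)
  show "\<Sqinter>(\<phi> ` Sigma I J) \<in> separator A" using assms by (simp add: valid_def)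
  fix i assume i: "i \<in> I"
  show "\<Sqinter>(\<phi> ` Sigma I J) \<sqsubseteq> \<Sqinter>((\<lambda>j. \<phi> (i, j)) ` J i)"
    using assms i by (intro inf_fun_greatest inf_fun_lower) auto
next
  show "(\<lambda>i. \<Sqinter> (\<lambda>j. \<phi> (i, j)) ` J i) \<in> I \<rightarrow> carrier A"
    using assms by (auto intro!: inf_fun_closed)
qed

subsection \<open>Implicational logic\<close>

lemma entails_k:
  assumes "a \<in> I \<rightarrow> carrier A" "b \<in> I \<rightarrow> carrier A"
  shows "entails A I a (\<lambda>i. b i \<leadsto> a i)"
  using valid_k[OF assms] by (simp add: entails_eq_valid)

lemma entails_s:
  assumes "a \<in> I \<rightarrow> carrier A" "b \<in> I \<rightarrow> carrier A" "c \<in> I \<rightarrow> carrier A"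
  shows "entails A I (\<lambda>i. a i \<leadsto> b i \<leadsto> c i) (\<lambda>i. (a i \<leadsto> b i) \<leadsto> a i \<leadsto> c i)"
  using valid_s[OF assms] by (simp add: entails_eq_valid)

lemma entails_of_valid:
  assumes "valid A I b" "a \<in> I \<rightarrow> carrier A" "b \<in> I \<rightarrow> carrier A"
  shows "entails A I a b"
  unfolding entails_eq_valid
  by (rule valid_mp[OF valid_k[of b I a]]) (use assms in auto)

lemma entails_mp:
  assumes "entails A I z (\<lambda>i. a i \<leadsto> b i)" "entails A I z a"
    and "z \<in> I \<rightarrow> carrier A" "a \<in> I \<rightarrow> carrier A" "b \<in> I \<rightarrow> carrier A"
  shows "entails A I z b"
proof -
  have "valid A I (\<lambda>i. (z i \<leadsto> a i) \<leadsto> (z i \<leadsto> b i))"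
    by (rule valid_mp[OF valid_s[of z I a b]])
      (use assms in \<open>auto simp: entails_eq_valid\<close>)
  then show ?thesis
    unfolding entails_eq_valid
    by (rule valid_mp) (use assms in \<open>auto simp: entails_eq_valid\<close>)
qed

lemma entails_refl:
  assumes "a \<in> I \<rightarrow> carrier A"
  shows "entails A I a a"
  by (rule entails_mp[OF entails_k[of a I "\<lambda>i. a i \<leadsto> a i"] entails_k[of a I a]])
    (use assms in auto)

lemma entails_trans:
  assumes "entails A I a b" "entails A I b c"
    and "a \<in> I \<rightarrow> carrier A" "b \<in> I \<rightarrow> carrier A" "c \<in> I \<rightarrow> carrier A"
  shows "entails A I a c"
proof (rule entails_mp[OF _ assms(1)])
  show "entails A I a (\<lambda>i. b i \<leadsto> c i)"
    using assms by (intro entails_of_valid) (auto simp: entails_eq_valid)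
qed (use assms in auto)

lemma entails_reindex:
  assumes "entails A J a b" "h \<in> I \<rightarrow> J" "a \<in> J \<rightarrow> carrier A" "b \<in> J \<rightarrow> carrier A"
  shows "entails A I (\<lambda>i. a (h i)) (\<lambda>i. b (h i))"
  unfolding entails_eq_valid
  by (rule valid_mono[OF assms(1)[unfolded entails_eq_valid]]) (use assms in \<open>auto 0 3\<close>)

lemma entails_le:
  assumes "a \<in> I \<rightarrow> carrier A" "b \<in> I \<rightarrow> carrier A" "\<And>i. i \<in> I \<Longrightarrow> a i \<sqsubseteq> b i"
  shows "entails A I a b"
  unfolding entails_eq_valid
proof (rule valid_mono[OF entails_refl[OF assms(1), unfolded entails_eq_valid]])
  fix i assume "i \<in> I"
  then show "\<exists>j\<in>I. (a j \<leadsto> a j) \<sqsubseteq> (a i \<leadsto> b i)"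
    using assms by (intro bexI[of _ i] arr_monotone) auto
qed (use assms in auto)

lemma entails_postcompose:
  assumes "entails A I c c'"
    and "a \<in> I \<rightarrow> carrier A" "c \<in> I \<rightarrow> carrier A" "c' \<in> I \<rightarrow> carrier A"
  shows "entails A I (\<lambda>i. a i \<leadsto> c i) (\<lambda>i. a i \<leadsto> c' i)"
  unfolding entails_eq_valid
proof (rule valid_mp[OF valid_s[of a I c c']])
  show "valid A I (\<lambda>i. a i \<leadsto> c i \<leadsto> c' i)"
    using entails_of_valid[of I "\<lambda>i. c i \<leadsto> c' i" a] assms by (auto simp: entails_eq_valid)
qed (use assms in auto)

lemma entails_precompose:
  assumes "entails A I a' a"
    and "a' \<in> I \<rightarrow> carrier A" "a \<in> I \<rightarrow> carrier A" "c \<in> I \<rightarrow> carrier A"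
  shows "entails A I (\<lambda>i. a i \<leadsto> c i) (\<lambda>i. a' i \<leadsto> c i)"
proof (rule entails_mp)
  show "entails A I (\<lambda>i. a i \<leadsto> c i) (\<lambda>i. (a' i \<leadsto> a i) \<leadsto> a' i \<leadsto> c i)"
    by (rule entails_trans[OF entails_k[of _ I a'] entails_s[of a' I a c]]) (use assms in auto)
  show "entails A I (\<lambda>i. a i \<leadsto> c i) (\<lambda>i. a' i \<leadsto> a i)"
    using assms by (intro entails_of_valid) (auto simp: entails_eq_valid)
qed (use assms in auto)

lemma entails_swap:
  assumes "a \<in> I \<rightarrow> carrier A" "b \<in> I \<rightarrow> carrier A" "c \<in> I \<rightarrow> carrier A"
  shows "entails A I (\<lambda>i. a i \<leadsto> b i \<leadsto> c i) (\<lambda>i. b i \<leadsto> a i \<leadsto> c i)"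
  by (rule entails_trans[OF entails_s[of a I b c] entails_precompose[OF entails_k[of b I a]]])
    (use assms in auto)

lemma entails_exchange:
  assumes "entails A I a (\<lambda>i. b i \<leadsto> c i)"
    and "a \<in> I \<rightarrow> carrier A" "b \<in> I \<rightarrow> carrier A" "c \<in> I \<rightarrow> carrier A"
  shows "entails A I b (\<lambda>i. a i \<leadsto> c i)"
  unfolding entails_eq_valid
  by (rule valid_mp[OF entails_swap[of a I b c, unfolded entails_eq_valid]])
    (use assms in \<open>auto simp: entails_eq_valid\<close>)

subsection \<open>Second-order connectives\<close>

text \<open>
  The introduction and elimination rules of a universal quantifier over \<open>J i\<close>, for a matrix that is
  an implication: elimination holds because a meet is a lower bound, introduction by the
  combinator \<open>a\<close>.
\<close>

lemma entails_inf_imp_iff: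
  assumes "a \<in> I \<rightarrow> carrier A"
    and "\<And>i. i \<in> I \<Longrightarrow> b i \<in> J i \<rightarrow> carrier A" "\<And>i. i \<in> I \<Longrightarrow> c i \<in> J i \<rightarrow> carrier A"
  shows "entails A I a (\<lambda>i. \<Sqinter>((\<lambda>j. b i j \<leadsto> c i j) ` J i)) \<longleftrightarrow>
    entails A (Sigma I J) (\<lambda>(i, j). a i) (\<lambda>(i, j). b i j \<leadsto> c i j)" (is "?L \<longleftrightarrow> ?R")
proof
  have bc: "b i j \<in> carrier A" "c i j \<in> carrier A" if "i \<in> I" "j \<in> J i" for i j
    using assms that by auto
  have m: "(\<lambda>i. \<Sqinter>((\<lambda>j. b i j \<leadsto> c i j) ` J i)) \<in> I \<rightarrow> carrier A"
    using bc by (auto intro!: inf_fun_closed)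
  show ?R if ?L
  proof (rule entails_trans)
    show "entails A (Sigma I J) (\<lambda>(i, j). a i) (\<lambda>(i, j). \<Sqinter>((\<lambda>j. b i j \<leadsto> c i j) ` J i))"
      using entails_reindex[OF that _ assms(1) m, of fst "Sigma I J"]
      by (auto simp: case_prod_unfold)
    show "entails A (Sigma I J) (\<lambda>(i, j). \<Sqinter>((\<lambda>j. b i j \<leadsto> c i j) ` J i)) (\<lambda>(i, j). b i j \<leadsto> c i j)"
      using m bc by (intro entails_le) (auto intro!: inf_fun_lower)
  qed (use assms m bc in auto)
  show ?L if ?R
    unfolding entails_eq_valid
  proof (rule valid_mp[OF valid_a[of a I b J c]])
    show "valid A I (\<lambda>i. \<Sqinter>((\<lambda>j. a i \<leadsto> b i j \<leadsto> c i j) ` J i))"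
      using valid_Sigma[of I J "\<lambda>(i, j). a i \<leadsto> b i j \<leadsto> c i j"] that assms bc
      by (auto simp: entails_eq_valid case_prod_unfold)
    show "(\<lambda>i. \<Sqinter>((\<lambda>j. a i \<leadsto> b i j \<leadsto> c i j) ` J i)) \<in> I \<rightarrow> carrier A"
      using bc assms(1) by (auto intro!: inf_fun_closed)
  qed (use assms m in auto)
qed

end

text \<open>
  The binary meet of the carrier is no substitute for conjunction, because a separator need not
  contain the meet of two of its elements; the second-order encodings are used instead.  They
  have an implication under every outer meet, as \<open>entails_inf_imp_iff\<close> demands, and for the same
  reason the universal quantifier is the meet of the elements \<open>\<top> \<leadsto> x\<close>, which are equivalent to
  the elements \<open>x\<close> themselves.
\<close>

definition arrow_conj :: "'a arrow_structure \<Rightarrow> 'a \<Rightarrow> 'a \<Rightarrow> 'a" where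
  "arrow_conj A a b =
     \<Sqinter>\<^bsub>A\<^esub>((\<lambda>c. (a \<leadsto>\<^bsub>A\<^esub> b \<leadsto>\<^bsub>A\<^esub> c) \<leadsto>\<^bsub>A\<^esub> c) ` carrier A)"

definition arrow_disj :: "'a arrow_structure \<Rightarrow> 'a \<Rightarrow> 'a \<Rightarrow> 'a" where
  "arrow_disj A a b =
     \<Sqinter>\<^bsub>A\<^esub>((\<lambda>c. (a \<leadsto>\<^bsub>A\<^esub> c) \<leadsto>\<^bsub>A\<^esub> (b \<leadsto>\<^bsub>A\<^esub> c) \<leadsto>\<^bsub>A\<^esub> c) ` carrier A)"

definition arrow_all :: "'a arrow_structure \<Rightarrow> 'a set \<Rightarrow> 'a" where
  "arrow_all A X = \<Sqinter>\<^bsub>A\<^esub>((\<lambda>x. \<top>\<^bsub>A\<^esub> \<leadsto>\<^bsub>A\<^esub> x) ` X)"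

definition arrow_ex :: "'a arrow_structure \<Rightarrow> 'a set \<Rightarrow> 'a" where
  "arrow_ex A X =
     \<Sqinter>\<^bsub>A\<^esub>((\<lambda>c. \<Sqinter>\<^bsub>A\<^esub>((\<lambda>x. x \<leadsto>\<^bsub>A\<^esub> c) ` X) \<leadsto>\<^bsub>A\<^esub> c) ` carrier A)"

context arrow_algebra
begin

lemma arrow_conj_closed [simp, intro]:
  "\<lbrakk>a \<in> carrier A; b \<in> carrier A\<rbrakk> \<Longrightarrow> arrow_conj A a b \<in> carrier A"
  unfolding arrow_conj_def by auto

lemma arrow_disj_closed [simp, intro]:
  "\<lbrakk>a \<in> carrier A; b \<in> carrier A\<rbrakk> \<Longrightarrow> arrow_disj A a b \<in> carrier A"
  unfolding arrow_disj_def by auto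

lemma arrow_all_closed [simp, intro]: "X \<subseteq> carrier A \<Longrightarrow> arrow_all A X \<in> carrier A"
  unfolding arrow_all_def by (intro inf_fun_closed) auto

lemma arrow_ex_closed [simp, intro]: "X \<subseteq> carrier A \<Longrightarrow> arrow_ex A X \<in> carrier A"
  unfolding arrow_ex_def by (intro inf_fun_closed Pi_I arr_closed) auto

lemma top_separator: "\<top> \<in> separator A"
  using combinator_k separator_closed separator_upward top_closed top_higher by blast

lemma valid_top: "valid A I (\<lambda>_. \<top>)"
  by (rule valid_of_separator[OF top_separator]) auto

lemma entails_conj1:
  assumes "a \<in> I \<rightarrow> carrier A" "b \<in> I \<rightarrow> carrier A"
  shows "entails A I (\<lambda>i. arrow_conj A (a i) (b i)) a"
proof (rule entails_mp)
  show "entails A I (\<lambda>i. arrow_conj A (a i) (b i)) (\<lambda>i. (a i \<leadsto> b i \<leadsto> a i) \<leadsto> a i)"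
    using assms by (intro entails_le) (auto simp: arrow_conj_def intro!: inf_lower)
  show "entails A I (\<lambda>i. arrow_conj A (a i) (b i)) (\<lambda>i. a i \<leadsto> b i \<leadsto> a i)"
    using assms by (intro entails_of_valid valid_k) auto
qed (use assms in auto)

lemma entails_conj2:
  assumes "a \<in> I \<rightarrow> carrier A" "b \<in> I \<rightarrow> carrier A"
  shows "entails A I (\<lambda>i. arrow_conj A (a i) (b i)) b"
proof (rule entails_mp)
  show "entails A I (\<lambda>i. arrow_conj A (a i) (b i)) (\<lambda>i. (a i \<leadsto> b i \<leadsto> b i) \<leadsto> b i)"
    using assms by (intro entails_le) (auto simp: arrow_conj_def intro!: inf_lower)
  have "entails A I a (\<lambda>i. b i \<leadsto> b i)"
    by (rule entails_of_valid[OF entails_refl[unfolded entails_eq_valid]]) (use assms in auto)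
  then show "entails A I (\<lambda>i. arrow_conj A (a i) (b i)) (\<lambda>i. a i \<leadsto> b i \<leadsto> b i)"
    using assms by (intro entails_of_valid) (auto simp: entails_eq_valid)
qed (use assms in auto)

text \<open>
  The Heyting adjunction.  From right to left it is modus ponens applied to the two projections.
  From left to right it suffices to have the pairing \<open>z \<turnstile> a \<leadsto> z \<and> a\<close>.
\<close>

lemma entails_curry:
  assumes "z \<in> I \<rightarrow> carrier A" "a \<in> I \<rightarrow> carrier A" "b \<in> I \<rightarrow> carrier A"
  shows "entails A I (\<lambda>i. arrow_conj A (z i) (a i)) b \<longleftrightarrow> entails A I z (\<lambda>i. a i \<leadsto> b i)"
    (is "?L \<longleftrightarrow> ?R")
proof
  show ?L if ?R
  proof (rule entails_mp)
    show "entails A I (\<lambda>i. arrow_conj A (z i) (a i)) (\<lambda>i. a i \<leadsto> b i)"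
      by (rule entails_trans[OF entails_conj1 that]) (use assms in auto)
    show "entails A I (\<lambda>i. arrow_conj A (z i) (a i)) a"
      by (rule entails_conj2) (use assms in auto)
  qed (use assms in auto)
  have pairing: "entails A I z (\<lambda>i. a i \<leadsto> arrow_conj A (z i) (a i))"
  proof (rule entails_trans)
    let ?J = "I \<times> carrier A" and ?X = "\<lambda>(i, c). z i \<leadsto> a i \<leadsto> c"
    \<comment> \<open>Moving the hypothesis \<open>?X\<close> behind \<open>a\<close> puts an implication under the meet over \<open>c\<close> twice:
      once to introduce the meet, and once to exchange it with \<open>a\<close>.\<close>
    have "entails A ?J (\<lambda>(i, c). z i) (\<lambda>p. a (fst p) \<leadsto> ?X p \<leadsto> snd p)"
    proof (rule entails_trans)
      show "entails A ?J (\<lambda>(i, c). z i) (\<lambda>p. ?X p \<leadsto> a (fst p) \<leadsto> snd p)"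
        using entails_refl[of ?X ?J] assms
        by (intro entails_exchange[of ?J ?X]) (auto simp: case_prod_unfold)
      show "entails A ?J (\<lambda>p. ?X p \<leadsto> a (fst p) \<leadsto> snd p) (\<lambda>p. a (fst p) \<leadsto> ?X p \<leadsto> snd p)"
        using assms by (intro entails_swap) auto
    qed (use assms in auto)
    then show "entails A I z
      (\<lambda>i. \<Sqinter>((\<lambda>c. a i \<leadsto> (z i \<leadsto> a i \<leadsto> c) \<leadsto> c) ` carrier A))"
      using assms by (subst entails_inf_imp_iff) (auto simp: case_prod_unfold)
    show "entails A I (\<lambda>i. \<Sqinter>((\<lambda>c. a i \<leadsto> (z i \<leadsto> a i \<leadsto> c) \<leadsto> c) ` carrier A))
      (\<lambda>i. a i \<leadsto> arrow_conj A (z i) (a i))"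
      unfolding entails_eq_valid arrow_conj_def using assms by (intro valid_a) auto
  qed (use assms in auto)
  show ?R if ?L
    by (rule entails_trans[OF pairing entails_postcompose[OF that]]) (use assms in auto)
qed

lemma entails_conjI:
  assumes "entails A I z a" "entails A I z b"
    and "z \<in> I \<rightarrow> carrier A" "a \<in> I \<rightarrow> carrier A" "b \<in> I \<rightarrow> carrier A"
  shows "entails A I z (\<lambda>i. arrow_conj A (a i) (b i))"
proof (rule entails_mp[OF _ assms(2)])
  have "entails A I a (\<lambda>i. b i \<leadsto> arrow_conj A (a i) (b i))"
    using assms entails_curry[of a I b "\<lambda>i. arrow_conj A (a i) (b i)"]
      entails_refl[of "\<lambda>i. arrow_conj A (a i) (b i)" I] by simp
  then show "entails A I z (\<lambda>i. b i \<leadsto> arrow_conj A (a i) (b i))"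
    by (rule entails_trans[OF assms(1)]) (use assms in auto)
qed (use assms in auto)

lemma entails_disjI1:
  assumes "a \<in> I \<rightarrow> carrier A" "b \<in> I \<rightarrow> carrier A"
  shows "entails A I a (\<lambda>i. arrow_disj A (a i) (b i))"
proof -
  let ?J = "I \<times> carrier A"
  have "entails A ?J (\<lambda>p. a (fst p)) (\<lambda>p. (a (fst p) \<leadsto> snd p) \<leadsto> (b (fst p) \<leadsto> snd p) \<leadsto> snd p)"
  proof (rule entails_exchange[OF entails_postcompose[OF entails_k]])
  qed (use assms in auto)
  then show ?thesis
    unfolding arrow_disj_def
    using assms by (subst entails_inf_imp_iff) (auto simp: case_prod_unfold)
qed

lemma entails_disjI2:
  assumes "a \<in> I \<rightarrow> carrier A" "b \<in> I \<rightarrow> carrier A"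
  shows "entails A I b (\<lambda>i. arrow_disj A (a i) (b i))"
proof -
  let ?J = "I \<times> carrier A"
  have "entails A ?J (\<lambda>p. (b (fst p) \<leadsto> snd p)) (\<lambda>p. b (fst p) \<leadsto> snd p)"
    by (rule entails_refl) (use assms in auto)
  then have "entails A ?J (\<lambda>p. b (fst p)) (\<lambda>p. (b (fst p) \<leadsto> snd p) \<leadsto> snd p)"
    by (rule entails_exchange) (use assms in auto)
  then have "entails A ?J (\<lambda>p. b (fst p)) (\<lambda>p. (a (fst p) \<leadsto> snd p) \<leadsto> (b (fst p) \<leadsto> snd p) \<leadsto> snd p)"
    by (rule entails_trans[OF _ entails_k]) (use assms in auto)
  then show ?thesis
    unfolding arrow_disj_def
    using assms by (subst entails_inf_imp_iff) (auto simp: case_prod_unfold)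
qed

lemma entails_disjE:
  assumes "entails A I a z" "entails A I b z"
    and "z \<in> I \<rightarrow> carrier A" "a \<in> I \<rightarrow> carrier A" "b \<in> I \<rightarrow> carrier A"
  shows "entails A I (\<lambda>i. arrow_disj A (a i) (b i)) z"
proof -
  let ?d = "\<lambda>i. arrow_disj A (a i) (b i)"
  have d1: "entails A I ?d (\<lambda>i. (a i \<leadsto> z i) \<leadsto> (b i \<leadsto> z i) \<leadsto> z i)"
    using assms by (intro entails_le) (auto simp: arrow_disj_def intro!: inf_lower)
  have d2: "entails A I ?d (\<lambda>i. a i \<leadsto> z i)" and d3: "entails A I ?d (\<lambda>i. b i \<leadsto> z i)"
    using entails_of_valid[OF assms(1)[unfolded entails_eq_valid], of ?d]
      entails_of_valid[OF assms(2)[unfolded entails_eq_valid], of ?d] assms by auto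
  show ?thesis
    by (rule entails_mp[OF entails_mp[OF d1 d2] d3]) (use assms in auto)
qed

text \<open>
  The matrix \<open>\<top> \<leadsto> x\<close> can be exchanged for \<open>x\<close> on the right of an entailment, because \<open>\<top>\<close> is
  valid.
\<close>

lemma entails_all_iff:
  assumes "z \<in> I \<rightarrow> carrier A" "\<And>i. i \<in> I \<Longrightarrow> X i \<subseteq> carrier A"
  shows "entails A I z (\<lambda>i. arrow_all A (X i)) \<longleftrightarrow> entails A (Sigma I X) (\<lambda>p. z (fst p)) snd"
    (is "_ \<longleftrightarrow> ?R")
proof -
  let ?S = "Sigma I X"
  have X: "x \<in> carrier A" if "i \<in> I" "x \<in> X i" for i x using assms that by blast
  have z: "(\<lambda>p. z (fst p)) \<in> ?S \<rightarrow> carrier A" and s: "snd \<in> ?S \<rightarrow> carrier A"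
    and t: "(\<lambda>_. \<top>) \<in> ?S \<rightarrow> carrier A" and ts: "(\<lambda>p. \<top> \<leadsto> snd p) \<in> ?S \<rightarrow> carrier A"
    using assms X by auto
  have "entails A I z (\<lambda>i. arrow_all A (X i)) \<longleftrightarrow>
      entails A ?S (\<lambda>p. z (fst p)) (\<lambda>p. \<top> \<leadsto> snd p)"
    unfolding arrow_all_def using assms
    by (subst entails_inf_imp_iff) (auto simp: case_prod_unfold Pi_iff)
  also have "\<dots> \<longleftrightarrow> ?R"
    using entails_mp[OF _ entails_of_valid[OF valid_top z t] z t s]
      entails_trans[OF _ entails_k[OF s t] z s ts] by blast
  finally show ?thesis .
qed

text \<open>
  Elimination instantiates the encoding at \<open>c = z i\<close>: its hypothesis, a meet of implications over
  \<open>X i\<close>, is then valid over \<open>I\<close> by assumption.  For introduction, the same meet lies below each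
  \<open>x \<leadsto> c\<close>, and exchanging the two hypotheses gives \<open>x \<turnstile> \<Sqinter>{x' \<leadsto> c | x'. x' \<in> X i} \<leadsto> c\<close>.
\<close>

lemma entails_ex_iff:
  assumes "z \<in> I \<rightarrow> carrier A" "\<And>i. i \<in> I \<Longrightarrow> X i \<subseteq> carrier A"
  shows "entails A I (\<lambda>i. arrow_ex A (X i)) z \<longleftrightarrow> entails A (Sigma I X) snd (\<lambda>p. z (fst p))"
    (is "?L \<longleftrightarrow> ?R")
proof
  let ?S = "Sigma I X"
  have X: "x \<in> carrier A" if "i \<in> I" "x \<in> X i" for i x using assms that by blast
  have e: "(\<lambda>i. arrow_ex A (X i)) \<in> I \<rightarrow> carrier A" using assms by auto
  show ?L if ?R
  proof (rule entails_mp)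
    let ?c = "\<lambda>i. \<Sqinter>((\<lambda>x. x \<leadsto> z i) ` X i)"
    show c: "?c \<in> I \<rightarrow> carrier A"
      using assms X by (auto intro!: inf_fun_closed)
    show "entails A I (\<lambda>i. arrow_ex A (X i)) (\<lambda>i. ?c i \<leadsto> z i)"
      using assms c e by (intro entails_le) (auto simp: arrow_ex_def intro!: inf_lower arr_closed inf_fun_closed dest: X)
    have "valid A I ?c"
      using valid_Sigma[of I X "\<lambda>p. snd p \<leadsto> z (fst p)"] that assms X
      by (auto simp: entails_eq_valid)
    then show "entails A I (\<lambda>i. arrow_ex A (X i)) ?c"
      using c e by (intro entails_of_valid)
  qed (use assms e in auto)
  have unit: "entails A ?S snd (\<lambda>p. arrow_ex A (X (fst p)))"
  proof -
    let ?J = "Sigma ?S (\<lambda>_. carrier A)"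
    let ?c = "\<lambda>((i, x), c). \<Sqinter>((\<lambda>x. x \<leadsto> c) ` X i)"
    have c: "?c \<in> ?J \<rightarrow> carrier A"
      using X by (auto intro!: inf_fun_closed)
    have "entails A ?J ?c (\<lambda>((i, x), c). x \<leadsto> c)"
      using c X by (intro entails_le) (auto intro!: inf_fun_lower[where \<phi> = "\<lambda>x. x \<leadsto> _"])
    then have "entails A ?J (\<lambda>((i, x), c). x) (\<lambda>p. ?c p \<leadsto> snd p)"
      using c X by (intro entails_exchange[of ?J ?c]) (auto simp: case_prod_unfold)
    then show ?thesis
      unfolding arrow_ex_def using X
      by (subst entails_inf_imp_iff) (auto simp: case_prod_unfold intro!: inf_fun_closed)
  qed
  show ?R if ?L
    by (rule entails_trans[OF unit entails_reindex[OF that, of fst]]) (use assms X e in auto)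
qed

end

section \<open>Heyting prealgebras from operations\<close>

lemma greatest_Lower_iff:
  fixes L (structure)
  assumes "F \<subseteq> carrier L"
  shows "greatest L n (Lower L F) \<longleftrightarrow>
    n \<in> carrier L \<and> (\<forall>x\<in>F. n \<sqsubseteq> x) \<and> (\<forall>z\<in>carrier L. (\<forall>x\<in>F. z \<sqsubseteq> x) \<longrightarrow> z \<sqsubseteq> n)"
  using assms unfolding greatest_def Lower_def by blast

lemma least_Upper_iff:
  fixes L (structure)
  assumes "F \<subseteq> carrier L"
  shows "least L n (Upper L F) \<longleftrightarrow>
    n \<in> carrier L \<and> (\<forall>x\<in>F. x \<sqsubseteq> n) \<and> (\<forall>z\<in>carrier L. (\<forall>x\<in>F. x \<sqsubseteq> z) \<longrightarrow> n \<sqsubseteq> z)"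
  using assms unfolding least_def Upper_def by blast

text \<open>
  The poset reflection is an operation on records that have no fields beyond those of an order,
  so the underlying type of \<open>L\<close> is restricted accordingly.
\<close>

locale gorder_preorder = weak_partial_order L for L :: "'a gorder" (structure)
begin

lemma class_of_eq_iff:
  assumes "x \<in> carrier L" "y \<in> carrier L"
  shows "class_of x = class_of y \<longleftrightarrow> x .= y"
  using assms unfolding eq_class_of_def by (blast intro: trans sym refl)

lemma carrier_poset_reflection: "carrier (poset_reflection L) = eq_class_of L ` carrier L"
  unfolding poset_reflection_def eq_classes_def by auto

lemma le_poset_reflection_iff:
  assumes "x \<in> carrier L" "y \<in> carrier L"
  shows "class_of x \<sqsubseteq>\<^bsub>poset_reflection L\<^esub> class_of y \<longleftrightarrow> x \<sqsubseteq> y"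
proof
  assume "class_of x \<sqsubseteq>\<^bsub>poset_reflection L\<^esub> class_of y"
  then obtain x' y' where "x' \<in> carrier L" "y' \<in> carrier L" "x .= x'" "y .= y'" "x' \<sqsubseteq> y'"
    unfolding poset_reflection_def eq_class_of_def by auto
  then show "x \<sqsubseteq> y" using assms le_cong by blast
next
  assume "x \<sqsubseteq> y"
  then show "class_of x \<sqsubseteq>\<^bsub>poset_reflection L\<^esub> class_of y"
    using assms unfolding poset_reflection_def eq_class_of_def by auto
qed

lemma partial_order_poset_reflection: "partial_order (poset_reflection L)"
proof -
  let ?R = "poset_reflection L"
  have eq: "eq ?R = (=)" by (simp add: poset_reflection_def)
  have refl: "K \<sqsubseteq>\<^bsub>?R\<^esub> K" if "K \<in> carrier ?R" for K
    using that by (force simp: carrier_poset_reflection le_poset_reflection_iff)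
  have antisym: "K = M"
    if KM: "K \<in> carrier ?R" "M \<in> carrier ?R" and le: "K \<sqsubseteq>\<^bsub>?R\<^esub> M" "M \<sqsubseteq>\<^bsub>?R\<^esub> K" for K M
  proof -
    obtain x y where xy: "K = class_of x" "M = class_of y" "x \<in> carrier L" "y \<in> carrier L"
      using KM unfolding carrier_poset_reflection by blast
    have "x .= y"
      using le xy(3,4) unfolding xy(1,2) by (intro weak_le_antisym) (simp_all add: le_poset_reflection_iff)
    then show ?thesis using xy class_of_eq_iff by simp
  qed
  have trans: "K \<sqsubseteq>\<^bsub>?R\<^esub> N"
    if KMN: "K \<in> carrier ?R" "M \<in> carrier ?R" "N \<in> carrier ?R"
      and le: "K \<sqsubseteq>\<^bsub>?R\<^esub> M" "M \<sqsubseteq>\<^bsub>?R\<^esub> N" for K M N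
  proof -
    obtain x y z where xyz: "K = class_of x" "M = class_of y" "N = class_of z"
      "x \<in> carrier L" "y \<in> carrier L" "z \<in> carrier L"
      using KMN unfolding carrier_poset_reflection by blast
    have "x \<sqsubseteq> z"
      by (rule le_trans[of x y z]) (use le xyz in \<open>simp_all add: le_poset_reflection_iff\<close>)
    then show ?thesis using xyz by (simp add: le_poset_reflection_iff)
  qed
  show ?thesis
    by unfold_locales (simp_all add: eq refl, (rule antisym trans; assumption)+)
qed

end

text \<open>
  Operations on a preorder with the universal properties of a Heyting algebra.  Chosen
  representatives are what one has in the fibres of a tripos; their classes are the corresponding
  operations of the poset reflection, and a map that preserves them up to isomorphism induces a
  Heyting morphism between the reflections.
\<close>

locale heyting_operations = gorder_preorder L for L :: "'a gorder" (structure) +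
  fixes tt ff :: 'a and cnj dsj imp :: "'a \<Rightarrow> 'a \<Rightarrow> 'a"
  assumes tt_closed: "tt \<in> carrier L" and ff_closed: "ff \<in> carrier L"
    and conj_closed: "\<lbrakk>x \<in> carrier L; y \<in> carrier L\<rbrakk> \<Longrightarrow> cnj x y \<in> carrier L"
    and disj_closed: "\<lbrakk>x \<in> carrier L; y \<in> carrier L\<rbrakk> \<Longrightarrow> dsj x y \<in> carrier L"
    and imp_closed: "\<lbrakk>x \<in> carrier L; y \<in> carrier L\<rbrakk> \<Longrightarrow> imp x y \<in> carrier L"
    and le_tt: "x \<in> carrier L \<Longrightarrow> x \<sqsubseteq> tt" and ff_le: "x \<in> carrier L \<Longrightarrow> ff \<sqsubseteq> x"
    and conj_le1: "\<lbrakk>x \<in> carrier L; y \<in> carrier L\<rbrakk> \<Longrightarrow> cnj x y \<sqsubseteq> x"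
    and conj_le2: "\<lbrakk>x \<in> carrier L; y \<in> carrier L\<rbrakk> \<Longrightarrow> cnj x y \<sqsubseteq> y"
    and le_conj: "\<lbrakk>x \<in> carrier L; y \<in> carrier L; z \<in> carrier L; z \<sqsubseteq> x; z \<sqsubseteq> y\<rbrakk> \<Longrightarrow> z \<sqsubseteq> cnj x y"
    and le_disj1: "\<lbrakk>x \<in> carrier L; y \<in> carrier L\<rbrakk> \<Longrightarrow> x \<sqsubseteq> dsj x y"
    and le_disj2: "\<lbrakk>x \<in> carrier L; y \<in> carrier L\<rbrakk> \<Longrightarrow> y \<sqsubseteq> dsj x y"
    and disj_le: "\<lbrakk>x \<in> carrier L; y \<in> carrier L; z \<in> carrier L; x \<sqsubseteq> z; y \<sqsubseteq> z\<rbrakk> \<Longrightarrow> dsj x y \<sqsubseteq> z"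
    and le_imp_iff:
      "\<lbrakk>x \<in> carrier L; y \<in> carrier L; z \<in> carrier L\<rbrakk> \<Longrightarrow> z \<sqsubseteq> imp x y \<longleftrightarrow> cnj z x \<sqsubseteq> y"
begin

abbreviation R :: "'a set gorder" where "R \<equiv> poset_reflection L"
abbreviation q :: "'a \<Rightarrow> 'a set" where "q \<equiv> eq_class_of L"

lemma class_of_closed: "x \<in> carrier L \<Longrightarrow> q x \<in> carrier R"
  by (simp add: carrier_poset_reflection)

lemmas reflection_simps = carrier_poset_reflection le_poset_reflection_iff
  tt_closed ff_closed conj_closed disj_closed imp_closed

lemma greatest_poset_reflection_conj:
  "\<lbrakk>x \<in> carrier L; y \<in> carrier L\<rbrakk> \<Longrightarrow> greatest R (q (cnj x y)) (Lower R {q x, q y})"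
  by (subst greatest_Lower_iff) (auto simp: reflection_simps conj_le1 conj_le2 le_conj)

lemma least_poset_reflection_disj:
  "\<lbrakk>x \<in> carrier L; y \<in> carrier L\<rbrakk> \<Longrightarrow> least R (q (dsj x y)) (Upper R {q x, q y})"
  by (subst least_Upper_iff) (auto simp: reflection_simps le_disj1 le_disj2 disj_le)

lemma greatest_poset_reflection_tt: "greatest R (q tt) (carrier R)"
  by (auto simp: greatest_def reflection_simps le_tt)

lemma least_poset_reflection_ff: "least R (q ff) (carrier R)"
  by (auto simp: least_def reflection_simps ff_le)

lemma bounded_lattice_poset_reflection: "bounded_lattice R"
proof -
  interpret R: partial_order R by (rule partial_order_poset_reflection)
  have glb: "\<exists>n. greatest R n (Lower R {K, M})" and lub: "\<exists>n. least R n (Upper R {K, M})"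
    if KM: "K \<in> carrier R" "M \<in> carrier R" for K M
  proof -
    obtain x y where xy: "K = q x" "M = q y" "x \<in> carrier L" "y \<in> carrier L"
      using KM by (auto simp: carrier_poset_reflection)
    show "\<exists>n. greatest R n (Lower R {K, M})"
      unfolding xy(1,2) by (rule exI, rule greatest_poset_reflection_conj[OF xy(3,4)])
    show "\<exists>n. least R n (Upper R {K, M})"
      unfolding xy(1,2) by (rule exI, rule least_poset_reflection_disj[OF xy(3,4)])
  qed
  have "\<exists>n. greatest R n (carrier R)" "\<exists>n. least R n (carrier R)"
    by (rule exI, rule greatest_poset_reflection_tt) (rule exI, rule least_poset_reflection_ff)
  with glb lub show ?thesis
    by unfold_locales assumption+
qed

sublocale reflection: bounded_lattice R
  by (rule bounded_lattice_poset_reflection)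

lemma meet_poset_reflection:
  assumes "x \<in> carrier L" "y \<in> carrier L"
  shows "q x \<sqinter>\<^bsub>R\<^esub> q y = q (cnj x y)"
  unfolding meet_def
  by (rule reflection.greatest_unique[OF reflection.inf_of_two_greatest
        greatest_poset_reflection_conj]) (use assms class_of_closed in auto)

lemma join_poset_reflection:
  assumes "x \<in> carrier L" "y \<in> carrier L"
  shows "q x \<squnion>\<^bsub>R\<^esub> q y = q (dsj x y)"
  unfolding join_def
  by (rule reflection.least_unique[OF reflection.sup_of_two_least
        least_poset_reflection_disj]) (use assms class_of_closed in auto)

lemma top_poset_reflection: "\<top>\<^bsub>R\<^esub> = q tt"
  using greatest_poset_reflection_tt reflection.top_greatest by (rule reflection.greatest_unique[rotated])

lemma bottom_poset_reflection: "\<bottom>\<^bsub>R\<^esub> = q ff"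
  using least_poset_reflection_ff reflection.bottom_least by (rule reflection.least_unique[rotated])

lemma is_heyting_imp_poset_reflection:
  assumes "x \<in> carrier L" "y \<in> carrier L"
  shows "is_heyting_imp R (q x) (q y) c \<longleftrightarrow> c = q (imp x y)"
proof -
  have "is_heyting_imp R (q x) (q y) (q (imp x y))"
    using assms unfolding is_heyting_imp_def greatest_def
    by (auto simp: meet_poset_reflection reflection_simps le_imp_iff[symmetric])
  then show ?thesis
    unfolding is_heyting_imp_def using reflection.greatest_unique by blast
qed

lemma heyting_prealgebra: "heyting_prealgebra L"
proof -
  have "heyting_algebra R"
    by unfold_locales (auto simp: carrier_poset_reflection is_heyting_imp_poset_reflection)
  then show ?thesis
    unfolding heyting_prealgebra_def using weak_partial_order_axioms by blast
qed

end

lemma monotone_map_cong: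
  assumes "monotone_map L M h" "x .=\<^bsub>L\<^esub> y" "x \<in> carrier L" "y \<in> carrier L"
  shows "h x .=\<^bsub>M\<^esub> h y"
proof -
  interpret L: weak_partial_order L using assms by (simp add: monotone_map_def isotone_def)
  interpret M: weak_partial_order M using assms by (simp add: monotone_map_def isotone_def)
  have "x \<sqsubseteq>\<^bsub>L\<^esub> y" "y \<sqsubseteq>\<^bsub>L\<^esub> x" using assms L.sym by auto
  then show ?thesis
    using assms by (intro M.weak_le_antisym) (auto simp: monotone_map_def isotone_def)
qed

lemma reflected_map_class_of:
  assumes "monotone_map L M h" "x \<in> carrier L"
  shows "reflected_map L M h (eq_class_of L x) = eq_class_of M (h x)"
proof -
  interpret L: weak_partial_order L using assms by (simp add: monotone_map_def isotone_def)
  interpret M: weak_partial_order M using assms by (simp add: monotone_map_def isotone_def)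
  have h: "h z \<in> carrier M" if "z \<in> carrier L" for z
    using assms that by (auto simp: monotone_map_def)
  have "(\<exists>z\<in>eq_class_of L x. h z .=\<^bsub>M\<^esub> y) \<longleftrightarrow> h x .=\<^bsub>M\<^esub> y" if y: "y \<in> carrier M" for y
  proof
    assume "\<exists>z\<in>eq_class_of L x. h z .=\<^bsub>M\<^esub> y"
    then obtain z where z: "z \<in> carrier L" "x .=\<^bsub>L\<^esub> z" "h z .=\<^bsub>M\<^esub> y"
      by (auto simp: eq_class_of_def)
    then show "h x .=\<^bsub>M\<^esub> y"
      using M.trans[OF monotone_map_cong[OF assms(1) z(2)] z(3)] assms(2) h y by simp
  qed (use assms(2) in \<open>auto simp: eq_class_of_def\<close>)
  then show ?thesis
    by (auto simp: reflected_map_def eq_class_of_def[of M])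
qed

lemma heyting_premorphismI:
  assumes L: "heyting_operations L tt ff cnj dsj imp"
    and M: "heyting_operations M tt' ff' cnj' dsj' imp'"
    and h: "monotone_map L M h"
    and tt: "h tt .=\<^bsub>M\<^esub> tt'" and ff: "h ff .=\<^bsub>M\<^esub> ff'"
    and cnj: "\<And>x y. \<lbrakk>x \<in> carrier L; y \<in> carrier L\<rbrakk> \<Longrightarrow> h (cnj x y) .=\<^bsub>M\<^esub> cnj' (h x) (h y)"
    and dsj: "\<And>x y. \<lbrakk>x \<in> carrier L; y \<in> carrier L\<rbrakk> \<Longrightarrow> h (dsj x y) .=\<^bsub>M\<^esub> dsj' (h x) (h y)"
    and imp: "\<And>x y. \<lbrakk>x \<in> carrier L; y \<in> carrier L\<rbrakk> \<Longrightarrow> h (imp x y) .=\<^bsub>M\<^esub> imp' (h x) (h y)"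
  shows "heyting_premorphism L M h"
proof -
  interpret L: heyting_operations L tt ff cnj dsj imp by (rule L)
  interpret M: heyting_operations M tt' ff' cnj' dsj' imp' by (rule M)
  have hc: "h x \<in> carrier M" if "x \<in> carrier L" for x
    using h that by (auto simp: monotone_map_def)
  have eq: "M.q (h tt) = M.q tt'" "M.q (h ff) = M.q ff'"
    and eq2: "\<And>x y. \<lbrakk>x \<in> carrier L; y \<in> carrier L\<rbrakk> \<Longrightarrow> M.q (h (cnj x y)) = M.q (cnj' (h x) (h y))"
    "\<And>x y. \<lbrakk>x \<in> carrier L; y \<in> carrier L\<rbrakk> \<Longrightarrow> M.q (h (dsj x y)) = M.q (dsj' (h x) (h y))"
    "\<And>x y. \<lbrakk>x \<in> carrier L; y \<in> carrier L\<rbrakk> \<Longrightarrow> M.q (h (imp x y)) = M.q (imp' (h x) (h y))"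
    using tt ff cnj dsj imp by (simp_all add: M.class_of_eq_iff hc L.reflection_simps M.reflection_simps)
  let ?h = "reflected_map L M h"
  note r = reflected_map_class_of[OF h]
  have "heyting_hom L.R M.R ?h"
    unfolding heyting_hom_def
  proof (intro conjI)
    show "?h \<in> carrier L.R \<rightarrow> carrier M.R"
      by (auto simp: L.carrier_poset_reflection r hc M.class_of_closed)
    show "?h \<top>\<^bsub>L.R\<^esub> = \<top>\<^bsub>M.R\<^esub>"
      by (simp add: L.top_poset_reflection M.top_poset_reflection r L.tt_closed eq)
    show "?h \<bottom>\<^bsub>L.R\<^esub> = \<bottom>\<^bsub>M.R\<^esub>"
      by (simp add: L.bottom_poset_reflection M.bottom_poset_reflection r L.ff_closed eq)
    show "meet_pres L.R M.R ?h"
      unfolding meet_pres_def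
      by (auto simp: L.reflection.lattice_axioms M.reflection.lattice_axioms L.carrier_poset_reflection
        L.meet_poset_reflection M.meet_poset_reflection r L.conj_closed hc eq2)
    show "join_pres L.R M.R ?h"
      unfolding join_pres_def
      by (auto simp: L.reflection.lattice_axioms M.reflection.lattice_axioms L.carrier_poset_reflection
        L.join_poset_reflection M.join_poset_reflection r L.disj_closed hc eq2)
    show "\<forall>a\<in>carrier L.R. \<forall>b\<in>carrier L.R. \<forall>c\<in>carrier L.R.
      is_heyting_imp L.R a b c \<longrightarrow> is_heyting_imp M.R (?h a) (?h b) (?h c)"
    proof (intro ballI impI)
      fix a b c assume a: "a \<in> carrier L.R" and b: "b \<in> carrier L.R" and imp: "is_heyting_imp L.R a b c"
      obtain x y where xy: "a = L.q x" "b = L.q y" "x \<in> carrier L" "y \<in> carrier L"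
        using a b unfolding L.carrier_poset_reflection by blast
      have "c = L.q (imp x y)"
        using imp xy by (simp add: L.is_heyting_imp_poset_reflection)
      then show "is_heyting_imp M.R (?h a) (?h b) (?h c)"
        using xy by (simp add: M.is_heyting_imp_poset_reflection r L.imp_closed hc eq2)
    qed
  qed
  then show ?thesis
    unfolding heyting_premorphism_def using h by blast
qed

text \<open>
  Preservation of the top element and of the chosen binary meets suffices: a meet of a finite set
  \<open>F\<close> can be built from these by induction on \<open>F\<close>, every other meet of \<open>F\<close> is isomorphic to
  it, and a monotone map preserves isomorphisms.
\<close>

lemma preserves_finite_meetsI:
  assumes L: "heyting_operations L tt ff cnj dsj imp"
    and M: "heyting_operations M tt' ff' cnj' dsj' imp'"
    and h: "monotone_map L M h"
    and tt: "tt' \<sqsubseteq>\<^bsub>M\<^esub> h tt"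
    and cnj: "\<And>x y. \<lbrakk>x \<in> carrier L; y \<in> carrier L\<rbrakk> \<Longrightarrow> cnj' (h x) (h y) \<sqsubseteq>\<^bsub>M\<^esub> h (cnj x y)"
  shows "preserves_finite_meets L M h"
  unfolding preserves_finite_meets_def
proof (intro allI impI)
  interpret L: heyting_operations L tt ff cnj dsj imp by (rule L)
  interpret M: heyting_operations M tt' ff' cnj' dsj' imp' by (rule M)
  have hc: "h x \<in> carrier M" if "x \<in> carrier L" for x
    using h that by (auto simp: monotone_map_def)
  have hle: "h x \<sqsubseteq>\<^bsub>M\<^esub> h y" if "x \<sqsubseteq>\<^bsub>L\<^esub> y" "x \<in> carrier L" "y \<in> carrier L" for x y
    using h that by (auto simp: monotone_map_def isotone_def)
  fix F m assume F: "finite F" "F \<subseteq> carrier L" and m: "greatest L m (Lower L F)"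
  have "\<exists>n. greatest L n (Lower L F) \<and> (\<forall>z\<in>carrier M. (\<forall>x\<in>F. z \<sqsubseteq>\<^bsub>M\<^esub> h x) \<longrightarrow> z \<sqsubseteq>\<^bsub>M\<^esub> h n)"
    using F
  proof (induction F)
    case empty
    have "z \<sqsubseteq>\<^bsub>M\<^esub> h tt" if "z \<in> carrier M" for z
      using M.le_trans[OF M.le_tt tt] that hc L.tt_closed M.tt_closed by blast
    then show ?case
      by (intro exI[of _ tt]) (auto simp: greatest_def L.tt_closed L.le_tt)
  next
    case (insert x F)
    then obtain n where n: "greatest L n (Lower L F)"
      "\<And>z. z \<in> carrier M \<Longrightarrow> \<forall>x\<in>F. z \<sqsubseteq>\<^bsub>M\<^esub> h x \<Longrightarrow> z \<sqsubseteq>\<^bsub>M\<^esub> h n"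
      by auto
    have x: "x \<in> carrier L" and F: "F \<subseteq> carrier L" using insert by auto
    have nc: "n \<in> carrier L" and nle: "\<And>y. y \<in> F \<Longrightarrow> n \<sqsubseteq>\<^bsub>L\<^esub> y"
      and ngr: "\<And>z. \<lbrakk>z \<in> carrier L; \<forall>y\<in>F. z \<sqsubseteq>\<^bsub>L\<^esub> y\<rbrakk> \<Longrightarrow> z \<sqsubseteq>\<^bsub>L\<^esub> n"
      using n(1) F by (auto simp: greatest_Lower_iff)
    have "cnj x n \<sqsubseteq>\<^bsub>L\<^esub> y" if "y \<in> F" for y
      using L.le_trans[OF L.conj_le2[OF x nc] nle[OF that]] x nc F that L.conj_closed by blast
    then have "greatest L (cnj x n) (Lower L (insert x F))"
      using x F nc ngr by (subst greatest_Lower_iff) (auto simp: L.conj_closed L.conj_le1 intro!: L.le_conj)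
    moreover have "z \<sqsubseteq>\<^bsub>M\<^esub> h (cnj x n)" if "z \<in> carrier M" "\<forall>y\<in>insert x F. z \<sqsubseteq>\<^bsub>M\<^esub> h y" for z
    proof -
      have "z \<sqsubseteq>\<^bsub>M\<^esub> cnj' (h x) (h n)"
        using that n(2) x nc by (intro M.le_conj) (auto simp: hc)
      then show ?thesis
        using M.le_trans[OF _ cnj[OF x nc]] that x nc by (auto simp: hc M.conj_closed L.conj_closed)
    qed
    ultimately show ?case by blast
  qed
  then obtain n where n: "greatest L n (Lower L F)"
    "\<And>z. z \<in> carrier M \<Longrightarrow> \<forall>x\<in>F. z \<sqsubseteq>\<^bsub>M\<^esub> h x \<Longrightarrow> z \<sqsubseteq>\<^bsub>M\<^esub> h n"
    by auto
  have mc: "m \<in> carrier L" "n \<in> carrier L" and mle: "\<And>y. y \<in> F \<Longrightarrow> m \<sqsubseteq>\<^bsub>L\<^esub> y" and nm: "n \<sqsubseteq>\<^bsub>L\<^esub> m"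
    using m n(1) F by (auto simp: greatest_Lower_iff)
  have "h m \<sqsubseteq>\<^bsub>M\<^esub> h x" if "x \<in> F" for x
    using hle[OF mle] that F mc by blast
  moreover have "z \<sqsubseteq>\<^bsub>M\<^esub> h m" if "z \<in> carrier M" "\<forall>x\<in>F. z \<sqsubseteq>\<^bsub>M\<^esub> h x" for z
    using M.le_trans[OF n(2)[OF that] hle[OF nm]] that mc hc by blast
  moreover have "h ` F \<subseteq> carrier M" using F hc by auto
  ultimately show "greatest M (h m) (Lower M (h ` F))"
    using hc[OF mc(1)] by (simp add: greatest_Lower_iff)
qed

lemma left_adjoint_unique:
  assumes "adjoint_maps L M l r" "adjoint_maps L M l' r" "x \<in> carrier L"
  shows "l x .=\<^bsub>M\<^esub> l' x"
proof -
  interpret M: weak_partial_order M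
    using assms by (simp add: adjoint_maps_def monotone_map_def isotone_def)
  have c: "l x \<in> carrier M" "l' x \<in> carrier M"
    using assms by (auto simp: adjoint_maps_def monotone_map_def)
  have "l x \<sqsubseteq>\<^bsub>M\<^esub> y \<longleftrightarrow> l' x \<sqsubseteq>\<^bsub>M\<^esub> y" if "y \<in> carrier M" for y
    using assms that unfolding adjoint_maps_def by blast
  then have "l x \<sqsubseteq>\<^bsub>M\<^esub> l' x" "l' x \<sqsubseteq>\<^bsub>M\<^esub> l x"
    using c M.le_refl by blast+
  then show ?thesis
    using c by (intro M.weak_le_antisym)
qed

lemma right_adjoint_unique:
  assumes "adjoint_maps L M l r" "adjoint_maps L M l r'" "y \<in> carrier M"
  shows "r y .=\<^bsub>L\<^esub> r' y"
proof -
  interpret L: weak_partial_order L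
    using assms by (simp add: adjoint_maps_def monotone_map_def isotone_def)
  have c: "r y \<in> carrier L" "r' y \<in> carrier L"
    using assms by (auto simp: adjoint_maps_def monotone_map_def)
  have "x \<sqsubseteq>\<^bsub>L\<^esub> r y \<longleftrightarrow> x \<sqsubseteq>\<^bsub>L\<^esub> r' y" if "x \<in> carrier L" for x
    using assms that unfolding adjoint_maps_def by blast
  then have "r y \<sqsubseteq>\<^bsub>L\<^esub> r' y" "r' y \<sqsubseteq>\<^bsub>L\<^esub> r y"
    using c L.le_refl by blast+
  then show ?thesis
    using c by (intro L.weak_le_antisym)
qed

text \<open>Monotonicity of an adjoint follows from the equivalence that defines it.\<close>

lemma left_adjointI:
  assumes L: "weak_partial_order L" and r: "monotone_map M L r"
    and l: "\<And>x. x \<in> carrier L \<Longrightarrow> l x \<in> carrier M"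
    and adj: "\<And>x y. \<lbrakk>x \<in> carrier L; y \<in> carrier M\<rbrakk> \<Longrightarrow> l x \<sqsubseteq>\<^bsub>M\<^esub> y \<longleftrightarrow> x \<sqsubseteq>\<^bsub>L\<^esub> r y"
  shows "adjoint_maps L M l r"
proof -
  interpret L: weak_partial_order L by (rule L)
  interpret M: weak_partial_order M using r by (simp add: monotone_map_def isotone_def)
  have rc: "r y \<in> carrier L" if "y \<in> carrier M" for y using r that by (auto simp: monotone_map_def)
  have "l x \<sqsubseteq>\<^bsub>M\<^esub> l y" if "x \<in> carrier L" "y \<in> carrier L" "x \<sqsubseteq>\<^bsub>L\<^esub> y" for x y
    using that l adj[of x "l y"] adj[of y "l y"] L.le_trans[of x y "r (l y)"] rc by auto
  then show ?thesis
    using assms unfolding adjoint_maps_def monotone_map_def isotone_def by auto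
qed

lemma right_adjointI:
  assumes M: "weak_partial_order M" and l: "monotone_map L M l"
    and r: "\<And>y. y \<in> carrier M \<Longrightarrow> r y \<in> carrier L"
    and adj: "\<And>x y. \<lbrakk>x \<in> carrier L; y \<in> carrier M\<rbrakk> \<Longrightarrow> l x \<sqsubseteq>\<^bsub>M\<^esub> y \<longleftrightarrow> x \<sqsubseteq>\<^bsub>L\<^esub> r y"
  shows "adjoint_maps L M l r"
proof -
  interpret M: weak_partial_order M by (rule M)
  interpret L: weak_partial_order L using l by (simp add: monotone_map_def isotone_def)
  have lc: "l y \<in> carrier M" if "y \<in> carrier L" for y using l that by (auto simp: monotone_map_def)
  have "r x \<sqsubseteq>\<^bsub>L\<^esub> r y" if "x \<in> carrier M" "y \<in> carrier M" "x \<sqsubseteq>\<^bsub>M\<^esub> y" for x y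
    using that r adj[of "r x" x] adj[of "r x" y] M.le_trans[of "l (r x)" x y] lc by auto
  then show ?thesis
    using assms unfolding adjoint_maps_def monotone_map_def isotone_def by auto
qed

section \<open>The tripos of an arrow algebra\<close>

lemma arrow_tripos_simps [simp]:
  "carrier (fibre (arrow_tripos A) I) = I \<rightarrow>\<^sub>E carrier A"
  "le (fibre (arrow_tripos A) I) = entails A I"
  "eq (fibre (arrow_tripos A) I) = (\<lambda>\<phi> \<psi>. entails A I \<phi> \<psi> \<and> entails A I \<psi> \<phi>)"
  "reindex (arrow_tripos A) I J f = (\<lambda>\<phi>. compose I \<phi> f)"
  by (simp_all add: arrow_tripos_def)

lemma entails_restrict [simp]:
  "entails A I (restrict \<phi> I) \<psi> \<longleftrightarrow> entails A I \<phi> \<psi>"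
  "entails A I \<phi> (restrict \<psi> I) \<longleftrightarrow> entails A I \<phi> \<psi>"
  by (rule entails_cong; simp)+

text \<open>
  A pullback square identifies the fibre of \<open>f\<close> over \<open>g y\<close> with the fibre of \<open>q\<close> over \<open>y\<close>.
  Quantification along \<open>f\<close> and along \<open>q\<close> hence ranges over the same set of values, from which the
  Beck--Chevalley conditions follow.
\<close>

lemma set_pullback_fibre:
  assumes "set_pullback W X Y Z p q f g" "y \<in> Y"
  shows "{x \<in> X. f x = g y} = p ` {w \<in> W. q w = y}"
proof -
  have "(\<lambda>w. (p w, q w)) ` W = {(x, y) \<in> X \<times> Y. f x = g y}"
    using assms by (simp add: set_pullback_def bij_betw_def)
  then have "(x, y) \<in> (\<lambda>w. (p w, q w)) ` W \<longleftrightarrow> x \<in> X \<and> f x = g y" for x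
    using assms(2) by simp
  then show ?thesis by auto
qed

context arrow_algebra
begin

lemma weak_partial_order_arrow_tripos: "weak_partial_order (fibre (arrow_tripos A) I)"
proof -
  have refl: "entails A I a a" if "a \<in> I \<rightarrow>\<^sub>E carrier A" for a
    using that by (intro entails_refl) (auto simp: PiE_iff)
  have trans: "entails A I a c" if "entails A I a b" "entails A I b c"
    "a \<in> I \<rightarrow>\<^sub>E carrier A" "b \<in> I \<rightarrow>\<^sub>E carrier A" "c \<in> I \<rightarrow>\<^sub>E carrier A" for a b c
    by (rule entails_trans[OF that(1,2)]) (use that in \<open>auto simp: PiE_iff\<close>)
  show ?thesis
    by unfold_locales (simp_all add: refl, (blast intro: trans)+)
qed

lemma heyting_operations_arrow_tripos:
  "heyting_operations (fibre (arrow_tripos A) I) (\<lambda>i\<in>I. \<top>) (\<lambda>i\<in>I. \<bottom>)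
     (\<lambda>\<phi> \<psi>. \<lambda>i\<in>I. arrow_conj A (\<phi> i) (\<psi> i)) (\<lambda>\<phi> \<psi>. \<lambda>i\<in>I. arrow_disj A (\<phi> i) (\<psi> i))
     (\<lambda>\<phi> \<psi>. \<lambda>i\<in>I. \<phi> i \<leadsto> \<psi> i)"
proof -
  interpret gorder_preorder "fibre (arrow_tripos A) I"
    by (simp add: gorder_preorder_def weak_partial_order_arrow_tripos)
  show ?thesis
    by unfold_locales
      (auto simp: PiE_iff entails_curry[symmetric] intro: entails_le entails_conj1 entails_conj2 entails_conjI
        entails_disjI1 entails_disjI2 entails_disjE)
qed

lemma monotone_map_reindex_arrow_tripos:
  assumes "f \<in> X \<rightarrow>\<^sub>E Y"
  shows "monotone_map (fibre (arrow_tripos A) Y) (fibre (arrow_tripos A) X)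
    (reindex (arrow_tripos A) X Y f)"
  using assms weak_partial_order_arrow_tripos
  by (auto simp: monotone_map_def isotone_def compose_def PiE_iff intro!: entails_reindex[where J = Y])

text \<open>
  By \<open>entails_ex_iff\<close> the entailment \<open>\<exists>\<^sub>f \<phi> \<turnstile> \<psi>\<close> is an entailment over the set of all pairs of
  \<open>y\<close> and a value of \<open>\<phi>\<close> on the fibre over \<open>y\<close>, and this set is the image of \<open>X\<close> under
  \<open>x \<mapsto> (f x, \<phi> x)\<close>.  The right adjoint is treated in the same way.
\<close>

lemma left_adjoint_arrow_tripos:
  assumes f: "f \<in> X \<rightarrow>\<^sub>E Y"
  shows "adjoint_maps (fibre (arrow_tripos A) X) (fibre (arrow_tripos A) Y)
    (\<lambda>\<phi>. \<lambda>y\<in>Y. arrow_ex A (\<phi> ` {x \<in> X. f x = y})) (reindex (arrow_tripos A) X Y f)"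
proof (rule left_adjointI)
  fix \<phi> \<psi> assume "\<phi> \<in> carrier (fibre (arrow_tripos A) X)" "\<psi> \<in> carrier (fibre (arrow_tripos A) Y)"
  then have \<phi>: "\<phi> \<in> X \<rightarrow> carrier A" and \<psi>: "\<psi> \<in> Y \<rightarrow> carrier A" by (auto simp: PiE_iff)
  let ?F = "\<lambda>y. \<phi> ` {x \<in> X. f x = y}"
  have "Sigma Y ?F = (\<lambda>x. (f x, \<phi> x)) ` X" using f by (auto simp: PiE_iff)
  moreover have "entails A Y (\<lambda>y. arrow_ex A (?F y)) \<psi> \<longleftrightarrow> entails A (Sigma Y ?F) snd (\<lambda>p. \<psi> (fst p))"
    using \<phi> \<psi> by (intro entails_ex_iff) auto
  ultimately show "((\<lambda>y\<in>Y. arrow_ex A (?F y)) \<sqsubseteq>\<^bsub>fibre (arrow_tripos A) Y\<^esub> \<psi>) \<longleftrightarrow>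
      \<phi> \<sqsubseteq>\<^bsub>fibre (arrow_tripos A) X\<^esub> reindex (arrow_tripos A) X Y f \<psi>"
    by (simp add: entails_image compose_def)
next
  fix \<phi> assume "\<phi> \<in> carrier (fibre (arrow_tripos A) X)"
  then show "(\<lambda>y\<in>Y. arrow_ex A (\<phi> ` {x \<in> X. f x = y})) \<in> carrier (fibre (arrow_tripos A) Y)"
    by (auto simp: PiE_iff intro!: arrow_ex_closed)
qed (rule weak_partial_order_arrow_tripos monotone_map_reindex_arrow_tripos[OF f])+

lemma right_adjoint_arrow_tripos:
  assumes f: "f \<in> X \<rightarrow>\<^sub>E Y"
  shows "adjoint_maps (fibre (arrow_tripos A) Y) (fibre (arrow_tripos A) X)
    (reindex (arrow_tripos A) X Y f) (\<lambda>\<phi>. \<lambda>y\<in>Y. arrow_all A (\<phi> ` {x \<in> X. f x = y}))"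
proof (rule right_adjointI)
  fix \<psi> \<phi> assume "\<psi> \<in> carrier (fibre (arrow_tripos A) Y)" "\<phi> \<in> carrier (fibre (arrow_tripos A) X)"
  then have \<phi>: "\<phi> \<in> X \<rightarrow> carrier A" and \<psi>: "\<psi> \<in> Y \<rightarrow> carrier A" by (auto simp: PiE_iff)
  let ?F = "\<lambda>y. \<phi> ` {x \<in> X. f x = y}"
  have "Sigma Y ?F = (\<lambda>x. (f x, \<phi> x)) ` X" using f by (auto simp: PiE_iff)
  moreover have "entails A Y \<psi> (\<lambda>y. arrow_all A (?F y)) \<longleftrightarrow> entails A (Sigma Y ?F) (\<lambda>p. \<psi> (fst p)) snd"
    using \<phi> \<psi> by (intro entails_all_iff) auto
  ultimately show "(reindex (arrow_tripos A) X Y f \<psi> \<sqsubseteq>\<^bsub>fibre (arrow_tripos A) X\<^esub> \<phi>) \<longleftrightarrow>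
      \<psi> \<sqsubseteq>\<^bsub>fibre (arrow_tripos A) Y\<^esub> (\<lambda>y\<in>Y. arrow_all A (?F y))"
    by (simp add: entails_image compose_def)
next
  fix \<phi> assume "\<phi> \<in> carrier (fibre (arrow_tripos A) X)"
  then show "(\<lambda>y\<in>Y. arrow_all A (\<phi> ` {x \<in> X. f x = y})) \<in> carrier (fibre (arrow_tripos A) Y)"
    by (auto simp: PiE_iff intro!: arrow_all_closed)
qed (rule weak_partial_order_arrow_tripos monotone_map_reindex_arrow_tripos[OF f])+

lemma tripos_arrow_tripos:
  assumes "carrier A \<in> \<U>"
  shows "tripos \<U> (arrow_tripos A)"
proof
  let ?P = "arrow_tripos A"
  have eq_refl: "\<phi> .=\<^bsub>fibre ?P X\<^esub> \<phi>" if "\<phi> \<in> carrier (fibre ?P X)" for X \<phi>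
    using that by (auto simp: PiE_iff intro: entails_refl)
  have eq_trans: "a .=\<^bsub>fibre ?P X\<^esub> c"
    if "a .=\<^bsub>fibre ?P X\<^esub> b" "b .=\<^bsub>fibre ?P X\<^esub> c" "a \<in> carrier (fibre ?P X)"
      "b \<in> carrier (fibre ?P X)" "c \<in> carrier (fibre ?P X)" for X a b c
    using that weak_partial_order_arrow_tripos[of X]
    by (meson equivalence.trans weak_partial_order.axioms(1))
  have eq_sym: "b .=\<^bsub>fibre ?P X\<^esub> a" if "a .=\<^bsub>fibre ?P X\<^esub> b" for X a b
    using that by simp
  show "heyting_prealgebra (fibre ?P X)" for X
    by (rule heyting_operations.heyting_prealgebra[OF heyting_operations_arrow_tripos])
  show "heyting_premorphism (fibre ?P Y) (fibre ?P X) (reindex ?P X Y f)"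
    if f: "f \<in> X \<rightarrow>\<^sub>E Y" for X Y f
    by (rule heyting_premorphismI[OF heyting_operations_arrow_tripos heyting_operations_arrow_tripos
          monotone_map_reindex_arrow_tripos[OF f]])
      (use f in \<open>auto simp: compose_def PiE_iff intro!: entails_le\<close>)
  show "reindex ?P X X (\<lambda>x\<in>X. x) \<phi> .=\<^bsub>fibre ?P X\<^esub> \<phi>" if "\<phi> \<in> carrier (fibre ?P X)" for X \<phi>
    using that by (auto simp: compose_def PiE_iff intro!: entails_le)
  show "reindex ?P X Z (compose X g f) \<phi> .=\<^bsub>fibre ?P X\<^esub> reindex ?P X Y f (reindex ?P Y Z g \<phi>)"
    if "f \<in> X \<rightarrow>\<^sub>E Y" "g \<in> Y \<rightarrow>\<^sub>E Z" "\<phi> \<in> carrier (fibre ?P Z)" for X Y Z f g \<phi>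
    using that by (auto simp: compose_def PiE_iff intro!: entails_le)
  show "\<exists>E. adjoint_maps (fibre ?P X) (fibre ?P Y) E (reindex ?P X Y f)"
    if "f \<in> X \<rightarrow>\<^sub>E Y" for X Y f
    using left_adjoint_arrow_tripos[OF that] by blast
  show "\<exists>U. adjoint_maps (fibre ?P Y) (fibre ?P X) (reindex ?P X Y f) U"
    if "f \<in> X \<rightarrow>\<^sub>E Y" for X Y f
    using right_adjoint_arrow_tripos[OF that] by blast
  show "\<exists>\<Sigma>\<in>\<U>. \<exists>\<sigma>\<in>carrier (fibre ?P \<Sigma>). \<forall>X\<in>\<U>. \<forall>\<phi>\<in>carrier (fibre ?P X).
         \<exists>g\<in>X \<rightarrow>\<^sub>E \<Sigma>. \<phi> .=\<^bsub>fibre ?P X\<^esub> reindex ?P X \<Sigma> g \<sigma>"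
  proof (rule bexI[of _ "carrier A"], rule bexI[of _ "\<lambda>a\<in>carrier A. a"], intro ballI)
    fix X \<phi> assume \<phi>: "\<phi> \<in> carrier (fibre ?P X)"
    then show "\<exists>g\<in>X \<rightarrow>\<^sub>E carrier A. \<phi> .=\<^bsub>fibre ?P X\<^esub> reindex ?P X (carrier A) g (\<lambda>a\<in>carrier A. a)"
      by (intro bexI[of _ \<phi>]) (auto simp: compose_def PiE_iff intro!: entails_le)
  qed (use assms in auto)
  fix W X Y Z p q f g E\<^sub>f E\<^sub>q U\<^sub>f U\<^sub>q \<phi>
  assume pb: "set_pullback W X Y Z p q f g" and \<phi>: "\<phi> \<in> carrier (fibre ?P X)"
  have maps: "p \<in> W \<rightarrow>\<^sub>E X" "q \<in> W \<rightarrow>\<^sub>E Y" "f \<in> X \<rightarrow>\<^sub>E Z" "g \<in> Y \<rightarrow>\<^sub>E Z"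
    using pb by (auto simp: set_pullback_def)
  \<comment> \<open>The explicit adjoints satisfy both Beck--Chevalley conditions as equations; the
    arbitrary adjoints of the conditions are isomorphic to them.\<close>
  have fib: "\<phi> ` {x \<in> X. f x = g y} = reindex ?P W X p \<phi> ` {w \<in> W. q w = y}" if "y \<in> Y" for y
    by (auto simp: set_pullback_fibre[OF pb that] compose_def image_image intro!: image_cong)
  have p\<phi>: "reindex ?P W X p \<phi> \<in> carrier (fibre ?P W)"
    using \<phi> maps by (auto simp: compose_def PiE_iff)
  note g_mono = monotone_map_reindex_arrow_tripos[OF maps(4)]
  {
    let ?E = "\<lambda>X Y f \<phi>. \<lambda>y\<in>Y. arrow_ex A (\<phi> ` {x \<in> X. f x = y})"
    assume E\<^sub>f: "adjoint_maps (fibre ?P X) (fibre ?P Z) E\<^sub>f (reindex ?P X Z f)"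
      and E\<^sub>q: "adjoint_maps (fibre ?P W) (fibre ?P Y) E\<^sub>q (reindex ?P W Y q)"
    note Af = left_adjoint_arrow_tripos[OF maps(3)] and Aq = left_adjoint_arrow_tripos[OF maps(2)]
    have closed: "E\<^sub>f \<phi> \<in> carrier (fibre ?P Z)" "?E X Z f \<phi> \<in> carrier (fibre ?P Z)"
      "E\<^sub>q (reindex ?P W X p \<phi>) \<in> carrier (fibre ?P Y)"
      using E\<^sub>f Af E\<^sub>q \<phi> p\<phi> unfolding adjoint_maps_def monotone_map_def by blast+
    have "reindex ?P Y Z g (E\<^sub>f \<phi>) .=\<^bsub>fibre ?P Y\<^esub> reindex ?P Y Z g (?E X Z f \<phi>)"
      by (rule monotone_map_cong[OF g_mono left_adjoint_unique[OF E\<^sub>f Af \<phi>]]) (use closed in simp_all)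
    moreover have "reindex ?P Y Z g (?E X Z f \<phi>) = ?E W Y q (reindex ?P W X p \<phi>)"
      using maps(4) fib by (auto simp: fun_eq_iff compose_def PiE_iff)
    moreover have "?E W Y q (reindex ?P W X p \<phi>) .=\<^bsub>fibre ?P Y\<^esub> E\<^sub>q (reindex ?P W X p \<phi>)"
      by (rule left_adjoint_unique[OF Aq E\<^sub>q p\<phi>])
    ultimately show "reindex ?P Y Z g (E\<^sub>f \<phi>) .=\<^bsub>fibre ?P Y\<^esub> E\<^sub>q (reindex ?P W X p \<phi>)"
      using eq_trans closed g_mono unfolding monotone_map_def by (metis (no_types, lifting) Pi_mem)
  }
  {
    let ?U = "\<lambda>X Y f \<phi>. \<lambda>y\<in>Y. arrow_all A (\<phi> ` {x \<in> X. f x = y})"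
    assume U\<^sub>f: "adjoint_maps (fibre ?P Z) (fibre ?P X) (reindex ?P X Z f) U\<^sub>f"
      and U\<^sub>q: "adjoint_maps (fibre ?P Y) (fibre ?P W) (reindex ?P W Y q) U\<^sub>q"
    note Af = right_adjoint_arrow_tripos[OF maps(3)] and Aq = right_adjoint_arrow_tripos[OF maps(2)]
    have closed: "U\<^sub>f \<phi> \<in> carrier (fibre ?P Z)" "?U X Z f \<phi> \<in> carrier (fibre ?P Z)"
      "U\<^sub>q (reindex ?P W X p \<phi>) \<in> carrier (fibre ?P Y)"
      using U\<^sub>f Af U\<^sub>q \<phi> p\<phi> unfolding adjoint_maps_def monotone_map_def by blast+
    have "reindex ?P Y Z g (U\<^sub>f \<phi>) .=\<^bsub>fibre ?P Y\<^esub> reindex ?P Y Z g (?U X Z f \<phi>)"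
      by (rule monotone_map_cong[OF g_mono right_adjoint_unique[OF U\<^sub>f Af \<phi>]]) (use closed in simp_all)
    moreover have "reindex ?P Y Z g (?U X Z f \<phi>) = ?U W Y q (reindex ?P W X p \<phi>)"
      using maps(4) fib by (auto simp: fun_eq_iff compose_def PiE_iff)
    moreover have "?U W Y q (reindex ?P W X p \<phi>) .=\<^bsub>fibre ?P Y\<^esub> U\<^sub>q (reindex ?P W X p \<phi>)"
      by (rule right_adjoint_unique[OF Aq U\<^sub>q p\<phi>])
    ultimately show "reindex ?P Y Z g (U\<^sub>f \<phi>) .=\<^bsub>fibre ?P Y\<^esub> U\<^sub>q (reindex ?P W X p \<phi>)"
      using eq_trans closed g_mono unfolding monotone_map_def by (metis (no_types, lifting) Pi_mem)
  }
qed

end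

section \<open>The category of triposes\<close>

lemma monotone_mapD:
  assumes "monotone_map L M h"
  shows "weak_partial_order L" "weak_partial_order M" "x \<in> carrier L \<Longrightarrow> h x \<in> carrier M"
    "\<lbrakk>x \<in> carrier L; y \<in> carrier L; x \<sqsubseteq>\<^bsub>L\<^esub> y\<rbrakk> \<Longrightarrow> h x \<sqsubseteq>\<^bsub>M\<^esub> h y"
  using assms by (auto simp: monotone_map_def isotone_def)

lemma monotone_map_compose:
  assumes "monotone_map L M f" "monotone_map M N g"
  shows "monotone_map L N (compose (carrier L) g f)"
  using assms by (auto simp: monotone_map_def isotone_def compose_eq)

lemma preserves_finite_meets_compose:
  assumes f: "f \<in> carrier L \<rightarrow> carrier M"
    and "preserves_finite_meets L M f" "preserves_finite_meets M N g"
  shows "preserves_finite_meets L N (compose (carrier L) g f)"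
  unfolding preserves_finite_meets_def
proof (intro allI impI)
  fix F m assume F: "finite F" "F \<subseteq> carrier L" and m: "greatest L m (Lower L F)"
  have "greatest M (f m) (Lower M (f ` F))"
    using assms(2) F m unfolding preserves_finite_meets_def by blast
  moreover have "finite (f ` F)" "f ` F \<subseteq> carrier M" using F f by auto
  ultimately have "greatest N (g (f m)) (Lower N (g ` f ` F))"
    using assms(3) unfolding preserves_finite_meets_def by blast
  moreover have "g ` f ` F = compose (carrier L) g f ` F" "g (f m) = compose (carrier L) g f m"
    using F m by (auto simp: compose_eq subset_iff image_image intro!: image_cong)
  ultimately show "greatest N (compose (carrier L) g f m) (Lower N (compose (carrier L) g f ` F))"
    by simp
qed

context tripos
begin

lemma weak_partial_order_fibre: "X \<in> \<U> \<Longrightarrow> weak_partial_order (fibre P X)"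
  using fibre_heyting by (simp add: heyting_prealgebra_def)

lemma monotone_map_reindex:
  "\<lbrakk>X \<in> \<U>; Y \<in> \<U>; f \<in> X \<rightarrow>\<^sub>E Y\<rbrakk> \<Longrightarrow> monotone_map (fibre P Y) (fibre P X) (reindex P X Y f)"
  using reindex_heyting by (simp add: heyting_premorphism_def)

lemmas reindex_closed = monotone_mapD(3)[OF monotone_map_reindex]

end

lemma cartesian_transformation_id:
  assumes "tripos \<U> P"
  shows "cartesian_transformation \<U> P P (\<lambda>X\<in>\<U>. \<lambda>\<phi>\<in>carrier (fibre P X). \<phi>)"
proof -
  interpret tripos \<U> P by (rule assms)
  have "equivalence (fibre P X)" if "X \<in> \<U>" for X
    using weak_partial_order_fibre[OF that] by (simp add: weak_partial_order_def)
  then have "reindex P X Y f \<phi> .=\<^bsub>fibre P X\<^esub> reindex P X Y f \<phi>"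
    if "X \<in> \<U>" "Y \<in> \<U>" "f \<in> X \<rightarrow>\<^sub>E Y" "\<phi> \<in> carrier (fibre P Y)" for X Y f \<phi>
    using that reindex_closed by (blast intro: equivalence.refl)
  moreover have "preserves_finite_meets (fibre P X) (fibre P X) (\<lambda>\<phi>\<in>carrier (fibre P X). \<phi>)" for X
  proof -
    have "(\<lambda>\<phi>\<in>carrier (fibre P X). \<phi>) ` F = F" if "F \<subseteq> carrier (fibre P X)" for F
      using that by (auto simp: image_iff)
    then show ?thesis by (auto simp: preserves_finite_meets_def)
  qed
  ultimately show ?thesis
    using weak_partial_order_fibre
    by (auto simp: cartesian_transformation_def transformation_def monotone_map_def isotone_def reindex_closed)
qed

lemma cartesian_transformation_compose:
  assumes "tripos \<U> P" "tripos \<U> Q" "tripos \<U> R"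
    and \<Phi>: "cartesian_transformation \<U> P Q \<Phi>" and \<Psi>: "cartesian_transformation \<U> Q R \<Psi>"
  shows "cartesian_transformation \<U> P R (\<lambda>X\<in>\<U>. compose (carrier (fibre P X)) (\<Psi> X) (\<Phi> X))"
proof -
  interpret P: tripos \<U> P by (rule assms)
  interpret Q: tripos \<U> Q by (rule assms)
  interpret R: tripos \<U> R by (rule assms)
  have mono: "monotone_map (fibre P X) (fibre Q X) (\<Phi> X)" "monotone_map (fibre Q X) (fibre R X) (\<Psi> X)"
    and meets: "preserves_finite_meets (fibre P X) (fibre Q X) (\<Phi> X)"
      "preserves_finite_meets (fibre Q X) (fibre R X) (\<Psi> X)"
    if "X \<in> \<U>" for X
    using \<Phi> \<Psi> that by (simp_all add: cartesian_transformation_def transformation_def)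
  note closed = monotone_mapD(3)[OF mono(1)] monotone_mapD(3)[OF mono(2)]
    P.reindex_closed Q.reindex_closed R.reindex_closed
  have "\<Psi> X (\<Phi> X (reindex P X Y f \<phi>)) .=\<^bsub>fibre R X\<^esub> reindex R X Y f (\<Psi> Y (\<Phi> Y \<phi>))"
    if X: "X \<in> \<U>" and Y: "Y \<in> \<U>" and f: "f \<in> X \<rightarrow>\<^sub>E Y" and \<phi>: "\<phi> \<in> carrier (fibre P Y)" for X Y f \<phi>
  proof -
    interpret weak_partial_order "fibre R X" by (rule R.weak_partial_order_fibre[OF X])
    have "\<Phi> X (reindex P X Y f \<phi>) .=\<^bsub>fibre Q X\<^esub> reindex Q X Y f (\<Phi> Y \<phi>)"
      using \<Phi> X Y f \<phi> by (auto simp: cartesian_transformation_def transformation_def)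
    then have "\<Psi> X (\<Phi> X (reindex P X Y f \<phi>)) .=\<^bsub>fibre R X\<^esub> \<Psi> X (reindex Q X Y f (\<Phi> Y \<phi>))"
      by (rule monotone_map_cong[OF mono(2)[OF X]]) (use X Y f \<phi> closed in auto)
    moreover have "\<Psi> X (reindex Q X Y f (\<Phi> Y \<phi>)) .=\<^bsub>fibre R X\<^esub> reindex R X Y f (\<Psi> Y (\<Phi> Y \<phi>))"
      using \<Psi> X Y f closed(1)[OF Y \<phi>] unfolding cartesian_transformation_def transformation_def by blast
    ultimately show ?thesis
      by (rule trans) (use X Y f \<phi> closed in auto)
  qed
  then show ?thesis
    unfolding cartesian_transformation_def transformation_def
    using mono meets closed
    by (auto simp: compose_eq intro!: monotone_map_compose preserves_finite_meets_compose)
qed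

lemma preorder_enriched_category_Trip_cart: "preorder_enriched_category (Trip_cart \<U>)"
proof
  fix P assume "P \<in> Ob (Trip_cart \<U>)"
  then show "Idm (Trip_cart \<U>) P \<in> Hom (Trip_cart \<U>) P P"
    using cartesian_transformation_id[of \<U> P] by (auto simp: Trip_cart_def)
next
  fix P Q R \<Phi> \<Psi>
  assume "P \<in> Ob (Trip_cart \<U>)" "Q \<in> Ob (Trip_cart \<U>)" "R \<in> Ob (Trip_cart \<U>)"
    "\<Phi> \<in> Hom (Trip_cart \<U>) P Q" "\<Psi> \<in> Hom (Trip_cart \<U>) Q R"
  then show "Comp (Trip_cart \<U>) P Q R \<Psi> \<Phi> \<in> Hom (Trip_cart \<U>) P R"
    using cartesian_transformation_compose[of \<U> P Q R \<Phi> \<Psi>]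
    by (auto simp: Trip_cart_def PiE_iff compose_eq)
next
  fix P Q R S \<Phi> \<Psi> \<Theta>
  assume "\<Phi> \<in> Hom (Trip_cart \<U>) P Q" "\<Psi> \<in> Hom (Trip_cart \<U>) Q R" "\<Theta> \<in> Hom (Trip_cart \<U>) R S"
  then show "Comp (Trip_cart \<U>) P Q S (Comp (Trip_cart \<U>) Q R S \<Theta> \<Psi>) \<Phi> =
      Comp (Trip_cart \<U>) P R S \<Theta> (Comp (Trip_cart \<U>) P Q R \<Psi> \<Phi>)"
    by (auto simp: Trip_cart_def PiE_iff compose_eq compose_assoc[where B = "carrier (fibre Q _)"] intro!: restrict_ext)
next
  fix P Q \<Phi> assume *: "P \<in> Ob (Trip_cart \<U>)" "Q \<in> Ob (Trip_cart \<U>)" "\<Phi> \<in> Hom (Trip_cart \<U>) P Q"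
  then have ext: "\<Phi> \<in> extensional \<U>" "\<And>X. X \<in> \<U> \<Longrightarrow> \<Phi> X \<in> carrier (fibre P X) \<rightarrow>\<^sub>E carrier (fibre Q X)"
    and Q: "tripos \<U> Q"
    by (auto simp: Trip_cart_def PiE_iff)
  show "Comp (Trip_cart \<U>) P P Q \<Phi> (Idm (Trip_cart \<U>) P) = \<Phi>"
    by (rule extensionalityI[OF _ ext(1)]) (use ext(2) in \<open>auto simp: Trip_cart_def PiE_def intro!: compose_Id Id_compose\<close>)
  show "Comp (Trip_cart \<U>) P Q Q (Idm (Trip_cart \<U>) Q) \<Phi> = \<Phi>"
    by (rule extensionalityI[OF _ ext(1)]) (use ext(2) in \<open>auto simp: Trip_cart_def PiE_def intro!: compose_Id Id_compose\<close>)
  show "Hle (Trip_cart \<U>) P Q \<Phi> \<Phi>"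
    using ext(2) tripos.weak_partial_order_fibre[OF Q]
    by (auto simp: Trip_cart_def PiE_iff intro!: weak_partial_order.le_refl)
next
  fix P Q \<Phi> \<Psi> \<Theta>
  assume *: "P \<in> Ob (Trip_cart \<U>)" "Q \<in> Ob (Trip_cart \<U>)"
    "\<Phi> \<in> Hom (Trip_cart \<U>) P Q" "\<Psi> \<in> Hom (Trip_cart \<U>) P Q" "\<Theta> \<in> Hom (Trip_cart \<U>) P Q"
    and le: "Hle (Trip_cart \<U>) P Q \<Phi> \<Psi>" "Hle (Trip_cart \<U>) P Q \<Psi> \<Theta>"
  show "Hle (Trip_cart \<U>) P Q \<Phi> \<Theta>"
    unfolding Trip_cart_def
  proof (simp, intro ballI)
    fix X \<phi> assume X: "X \<in> \<U>" and \<phi>: "\<phi> \<in> carrier (fibre P X)"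
    interpret weak_partial_order "fibre Q X"
      using tripos.weak_partial_order_fibre X *(2) by (auto simp: Trip_cart_def)
    show "\<Phi> X \<phi> \<sqsubseteq>\<^bsub>fibre Q X\<^esub> \<Theta> X \<phi>"
      by (rule le_trans[of _ "\<Psi> X \<phi>"]) (use * le X \<phi> in \<open>auto simp: Trip_cart_def PiE_iff\<close>)
  qed
next
  fix P Q R \<Phi> \<Phi>' \<Psi> \<Psi>'
  assume *: "P \<in> Ob (Trip_cart \<U>)" "Q \<in> Ob (Trip_cart \<U>)" "R \<in> Ob (Trip_cart \<U>)"
    "\<Phi> \<in> Hom (Trip_cart \<U>) P Q" "\<Phi>' \<in> Hom (Trip_cart \<U>) P Q"
    "\<Psi> \<in> Hom (Trip_cart \<U>) Q R" "\<Psi>' \<in> Hom (Trip_cart \<U>) Q R"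
    and le: "Hle (Trip_cart \<U>) P Q \<Phi> \<Phi>'" "Hle (Trip_cart \<U>) Q R \<Psi> \<Psi>'"
  show "Hle (Trip_cart \<U>) P R (Comp (Trip_cart \<U>) P Q R \<Psi> \<Phi>) (Comp (Trip_cart \<U>) P Q R \<Psi>' \<Phi>')"
    unfolding Trip_cart_def
  proof (simp add: compose_eq, intro ballI)
    fix X \<phi> assume X: "X \<in> \<U>" and \<phi>: "\<phi> \<in> carrier (fibre P X)"
    interpret weak_partial_order "fibre R X"
      using tripos.weak_partial_order_fibre X *(3) by (auto simp: Trip_cart_def)
    have closed: "\<Phi> X \<phi> \<in> carrier (fibre Q X)" "\<Phi>' X \<phi> \<in> carrier (fibre Q X)"
      using * X \<phi> by (auto simp: Trip_cart_def PiE_iff)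
    have mono: "monotone_map (fibre Q X) (fibre R X) (\<Psi> X)"
      using * X by (auto simp: Trip_cart_def cartesian_transformation_def transformation_def)
    show "\<Psi> X (\<Phi> X \<phi>) \<sqsubseteq>\<^bsub>fibre R X\<^esub> \<Psi>' X (\<Phi>' X \<phi>)"
    proof (rule le_trans[of _ "\<Psi> X (\<Phi>' X \<phi>)"])
      show "\<Psi> X (\<Phi> X \<phi>) \<sqsubseteq>\<^bsub>fibre R X\<^esub> \<Psi> X (\<Phi>' X \<phi>)"
        using le(1) X \<phi> by (intro monotone_mapD(4)[OF mono] closed) (auto simp: Trip_cart_def)
    qed (use * le X closed in \<open>auto simp: Trip_cart_def PiE_iff\<close>)
  qed
qed

section \<open>The category of arrow algebras\<close>

text \<open>
  The last two conditions on an implicative morphism are entailments over sets of pairs; a uniform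
  realizer \<open>r\<close> in the separator exists if and only if the meet of all instances is in the
  separator.
\<close>

lemma implicative_morphism_iff:
  assumes "arrow_algebra A" "arrow_algebra B"
  shows "implicative_morphism A B f \<longleftrightarrow>
    f \<in> carrier A \<rightarrow> carrier B \<and> (\<forall>a\<in>separator A. f a \<in> separator B) \<and>
    entails B (carrier A \<times> carrier A) (\<lambda>p. f (fst p \<leadsto>\<^bsub>A\<^esub> snd p)) (\<lambda>p. f (fst p) \<leadsto>\<^bsub>B\<^esub> f (snd p)) \<and>
    (\<forall>X. X \<subseteq> carrier A \<times> carrier A \<longrightarrow> entails A X fst snd \<longrightarrow>
      entails B X (\<lambda>p. f (fst p)) (\<lambda>p. f (snd p)))"
proof -
  interpret A: arrow_algebra A by (rule assms)
  interpret B: arrow_algebra B by (rule assms)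
  have "{a \<leadsto>\<^bsub>A\<^esub> a' | a a'. (a, a') \<in> X} = (\<lambda>p. fst p \<leadsto>\<^bsub>A\<^esub> snd p) ` X"
    "{f a \<leadsto>\<^bsub>B\<^esub> f a' | a a'. (a, a') \<in> X} = (\<lambda>p. f (fst p) \<leadsto>\<^bsub>B\<^esub> f (snd p)) ` X" for X
    by (auto intro: rev_image_eqI) blast+
  then have iii: "\<Sqinter>\<^bsub>A\<^esub>{a \<leadsto>\<^bsub>A\<^esub> a' | a a'. (a, a') \<in> X} \<in> separator A \<longleftrightarrow> entails A X fst snd"
    "\<Sqinter>\<^bsub>B\<^esub>{f a \<leadsto>\<^bsub>B\<^esub> f a' | a a'. (a, a') \<in> X} \<in> separator B \<longleftrightarrow>
      entails B X (\<lambda>p. f (fst p)) (\<lambda>p. f (snd p))" for X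
    by (simp_all only: entails_eq_valid valid_def)
  have ii: "(\<exists>r\<in>separator B. \<forall>a\<in>carrier A. \<forall>a'\<in>carrier A.
        r \<sqsubseteq>\<^bsub>B\<^esub> (f (a \<leadsto>\<^bsub>A\<^esub> a') \<leadsto>\<^bsub>B\<^esub> f a \<leadsto>\<^bsub>B\<^esub> f a')) \<longleftrightarrow>
    entails B (carrier A \<times> carrier A) (\<lambda>p. f (fst p \<leadsto>\<^bsub>A\<^esub> snd p)) (\<lambda>p. f (fst p) \<leadsto>\<^bsub>B\<^esub> f (snd p))"
    (is "?L \<longleftrightarrow> ?R") if f: "f \<in> carrier A \<rightarrow> carrier B"
  proof
    let ?\<phi> = "\<lambda>p. f (fst p \<leadsto>\<^bsub>A\<^esub> snd p) \<leadsto>\<^bsub>B\<^esub> f (fst p) \<leadsto>\<^bsub>B\<^esub> f (snd p)"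
    have \<phi>: "?\<phi> \<in> carrier A \<times> carrier A \<rightarrow> carrier B" using f by auto
    show ?R if L: ?L
    proof -
      obtain r where r: "r \<in> separator B" "\<forall>a\<in>carrier A. \<forall>a'\<in>carrier A.
          r \<sqsubseteq>\<^bsub>B\<^esub> (f (a \<leadsto>\<^bsub>A\<^esub> a') \<leadsto>\<^bsub>B\<^esub> f a \<leadsto>\<^bsub>B\<^esub> f a')"
        using L by blast
      show ?thesis
        unfolding entails_eq_valid by (rule B.valid_of_separator[OF r(1) \<phi>]) (use r(2) in auto)
    qed
    show ?L if ?R
    proof (intro bexI ballI)
      show "\<Sqinter>\<^bsub>B\<^esub>(?\<phi> ` (carrier A \<times> carrier A)) \<in> separator B"
        using that by (simp add: entails_eq_valid valid_def)
      fix a a' assume "a \<in> carrier A" "a' \<in> carrier A"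
      then show "\<Sqinter>\<^bsub>B\<^esub>(?\<phi> ` (carrier A \<times> carrier A)) \<sqsubseteq>\<^bsub>B\<^esub> (f (a \<leadsto>\<^bsub>A\<^esub> a') \<leadsto>\<^bsub>B\<^esub> f a \<leadsto>\<^bsub>B\<^esub> f a')"
        using B.inf_fun_lower[OF \<phi>, of "(a, a')"] by simp
    qed
  qed
  show ?thesis
    unfolding implicative_morphism_def iii using ii by blast
qed

text \<open>
  Only the set of the pairs \<open>(\<phi> i, \<psi> i)\<close> matters for \<open>\<phi> \<turnstile> \<psi>\<close>, so the third condition on \<open>f\<close> extends
  from sets of pairs to families over an arbitrary index set.
\<close>

lemma implicative_morphism_entails:
  assumes A: "arrow_algebra A" and B: "arrow_algebra B" and f: "implicative_morphism A B f"
    and \<phi>: "\<phi> \<in> I \<rightarrow> carrier A" and \<psi>: "\<psi> \<in> I \<rightarrow> carrier A" and "entails A I \<phi> \<psi>"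
  shows "entails B I (\<lambda>i. f (\<phi> i)) (\<lambda>i. f (\<psi> i))"
proof -
  let ?h = "\<lambda>i. (\<phi> i, \<psi> i)"
  have "entails A (?h ` I) fst snd" using assms(6) by (simp add: entails_image)
  moreover have "?h ` I \<subseteq> carrier A \<times> carrier A" using \<phi> \<psi> by auto
  ultimately have "entails B (?h ` I) (\<lambda>p. f (fst p)) (\<lambda>p. f (snd p))"
    using f unfolding implicative_morphism_iff[OF A B] by blast
  then show ?thesis by (simp add: entails_image)
qed

lemma implicative_morphism_id:
  assumes A: "arrow_algebra A"
  shows "implicative_morphism A A (\<lambda>a\<in>carrier A. a)"
proof -
  interpret arrow_algebra A by (rule A)
  let ?i = "\<lambda>a\<in>carrier A. a"
  have "entails A X (\<lambda>p. ?i (fst p)) (\<lambda>p. ?i (snd p)) \<longleftrightarrow> entails A X fst snd"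
    if "X \<subseteq> carrier A \<times> carrier A" for X
    using that by (intro entails_cong) auto
  moreover have "entails A (carrier A \<times> carrier A) (\<lambda>p. ?i (fst p \<leadsto>\<^bsub>A\<^esub> snd p))
      (\<lambda>p. ?i (fst p) \<leadsto>\<^bsub>A\<^esub> ?i (snd p))"
    by (rule entails_le) auto
  moreover have "?i \<in> carrier A \<rightarrow> carrier A" "\<forall>a\<in>separator A. ?i a \<in> separator A"
    using separator_closed by simp_all
  ultimately show ?thesis
    unfolding implicative_morphism_iff[OF A A] by blast
qed

lemma implicative_morphism_compose:
  assumes A: "arrow_algebra A" and B: "arrow_algebra B" and C: "arrow_algebra C"
    and f: "implicative_morphism A B f" and g: "implicative_morphism B C g"
  shows "implicative_morphism A C (compose (carrier A) g f)"
proof -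
  interpret A: arrow_algebra A by (rule A)
  interpret B: arrow_algebra B by (rule B)
  interpret C: arrow_algebra C by (rule C)
  have fc: "f a \<in> carrier B" if "a \<in> carrier A" for a
    using f that by (auto simp: implicative_morphism_def)
  have gc: "g b \<in> carrier C" if "b \<in> carrier B" for b
    using g that by (auto simp: implicative_morphism_def)
  let ?AA = "carrier A \<times> carrier A"
  have "entails C ?AA (\<lambda>p. g (f (fst p \<leadsto>\<^bsub>A\<^esub> snd p))) (\<lambda>p. g (f (fst p)) \<leadsto>\<^bsub>C\<^esub> g (f (snd p)))"
  proof (rule C.entails_trans)
    show "entails C ?AA (\<lambda>p. g (f (fst p \<leadsto>\<^bsub>A\<^esub> snd p))) (\<lambda>p. g (f (fst p) \<leadsto>\<^bsub>B\<^esub> f (snd p)))"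
      by (rule implicative_morphism_entails[OF B C g])
        (use f fc in \<open>auto simp: implicative_morphism_iff[OF A B]\<close>)
    have "entails C ((\<lambda>p. (f (fst p), f (snd p))) ` ?AA) (\<lambda>p. g (fst p \<leadsto>\<^bsub>B\<^esub> snd p))
        (\<lambda>p. g (fst p) \<leadsto>\<^bsub>C\<^esub> g (snd p))"
      using C.entails_reindex[of "carrier B \<times> carrier B" "\<lambda>p. g (fst p \<leadsto>\<^bsub>B\<^esub> snd p)"
          "\<lambda>p. g (fst p) \<leadsto>\<^bsub>C\<^esub> g (snd p)" "\<lambda>p. p"] g fc gc
      by (auto simp: implicative_morphism_iff[OF B C])
    then show "entails C ?AA (\<lambda>p. g (f (fst p) \<leadsto>\<^bsub>B\<^esub> f (snd p))) (\<lambda>p. g (f (fst p)) \<leadsto>\<^bsub>C\<^esub> g (f (snd p)))"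
      by (simp add: entails_image)
  qed (use fc gc in auto)
  then have ii: "entails C ?AA (\<lambda>p. compose (carrier A) g f (fst p \<leadsto>\<^bsub>A\<^esub> snd p))
      (\<lambda>p. compose (carrier A) g f (fst p) \<leadsto>\<^bsub>C\<^esub> compose (carrier A) g f (snd p))"
    by (subst entails_cong) (auto simp: compose_eq)
  have iii: "entails C X (\<lambda>p. compose (carrier A) g f (fst p)) (\<lambda>p. compose (carrier A) g f (snd p))"
    if X: "X \<subseteq> ?AA" "entails A X fst snd" for X
  proof -
    have "entails B X (\<lambda>p. f (fst p)) (\<lambda>p. f (snd p))"
      using f X unfolding implicative_morphism_iff[OF A B] by blast
    then have "entails C X (\<lambda>p. g (f (fst p))) (\<lambda>p. g (f (snd p)))"
      using X fc by (intro implicative_morphism_entails[OF B C g]) auto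
    then show ?thesis
      using X by (subst entails_cong[where \<phi>' = "\<lambda>p. g (f (fst p))" and \<psi>' = "\<lambda>p. g (f (snd p))"])
        (auto simp: compose_eq)
  qed
  show ?thesis
    unfolding implicative_morphism_iff[OF A C]
    using ii iii fc gc f g A.separator_closed
    by (auto simp: compose_eq implicative_morphism_def)
qed

lemma preorder_enriched_category_ArrAlg: "preorder_enriched_category (ArrAlg \<U>)"
proof
  fix A assume "A \<in> Ob (ArrAlg \<U>)"
  then show "Idm (ArrAlg \<U>) A \<in> Hom (ArrAlg \<U>) A A"
    by (auto simp: ArrAlg_def implicative_morphism_id)
next
  fix A B C f g
  assume "A \<in> Ob (ArrAlg \<U>)" "B \<in> Ob (ArrAlg \<U>)" "C \<in> Ob (ArrAlg \<U>)"
    "f \<in> Hom (ArrAlg \<U>) A B" "g \<in> Hom (ArrAlg \<U>) B C"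
  then show "Comp (ArrAlg \<U>) A B C g f \<in> Hom (ArrAlg \<U>) A C"
    using implicative_morphism_compose[of A B C f g]
    by (auto simp: ArrAlg_def PiE_iff compose_eq)
next
  fix A B C D f g h
  assume "f \<in> Hom (ArrAlg \<U>) A B" "g \<in> Hom (ArrAlg \<U>) B C" "h \<in> Hom (ArrAlg \<U>) C D"
  then show "Comp (ArrAlg \<U>) A B D (Comp (ArrAlg \<U>) B C D h g) f =
      Comp (ArrAlg \<U>) A C D h (Comp (ArrAlg \<U>) A B C g f)"
    by (auto simp: ArrAlg_def PiE_def intro!: compose_assoc[symmetric])
next
  fix A B f assume *: "A \<in> Ob (ArrAlg \<U>)" "B \<in> Ob (ArrAlg \<U>)" "f \<in> Hom (ArrAlg \<U>) A B"
  then show "Comp (ArrAlg \<U>) A A B f (Idm (ArrAlg \<U>) A) = f"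
    "Comp (ArrAlg \<U>) A B B (Idm (ArrAlg \<U>) B) f = f"
    by (auto simp: ArrAlg_def PiE_def intro!: compose_Id Id_compose)
  show "Hle (ArrAlg \<U>) A B f f"
    using * by (auto simp: ArrAlg_def PiE_iff intro!: arrow_algebra.entails_refl)
next
  fix A B f g h
  assume *: "A \<in> Ob (ArrAlg \<U>)" "B \<in> Ob (ArrAlg \<U>)"
    "f \<in> Hom (ArrAlg \<U>) A B" "g \<in> Hom (ArrAlg \<U>) A B" "h \<in> Hom (ArrAlg \<U>) A B"
    and le: "Hle (ArrAlg \<U>) A B f g" "Hle (ArrAlg \<U>) A B g h"
  have B: "arrow_algebra B" using * by (auto simp: ArrAlg_def)
  show "Hle (ArrAlg \<U>) A B f h"
    using * le arrow_algebra.entails_trans[OF B, of "carrier A" f g h]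
    by (auto simp: ArrAlg_def PiE_iff)
next
  fix A B C f f' g g'
  assume *: "A \<in> Ob (ArrAlg \<U>)" "B \<in> Ob (ArrAlg \<U>)" "C \<in> Ob (ArrAlg \<U>)"
    "f \<in> Hom (ArrAlg \<U>) A B" "f' \<in> Hom (ArrAlg \<U>) A B"
    "g \<in> Hom (ArrAlg \<U>) B C" "g' \<in> Hom (ArrAlg \<U>) B C"
    and le: "Hle (ArrAlg \<U>) A B f f'" "Hle (ArrAlg \<U>) B C g g'"
  interpret C: arrow_algebra C using * by (auto simp: ArrAlg_def)
  have closed: "f \<in> carrier A \<rightarrow> carrier B" "f' \<in> carrier A \<rightarrow> carrier B"
    "g \<in> carrier B \<rightarrow> carrier C" "g' \<in> carrier B \<rightarrow> carrier C"
    using * by (auto simp: ArrAlg_def PiE_iff)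
  have "entails C (carrier A) (\<lambda>a. g (f a)) (\<lambda>a. g' (f' a))"
  proof (rule C.entails_trans)
    show "entails C (carrier A) (\<lambda>a. g (f a)) (\<lambda>a. g (f' a))"
      by (rule implicative_morphism_entails[of B]) (use * le closed in \<open>auto simp: ArrAlg_def\<close>)
    show "entails C (carrier A) (\<lambda>a. g (f' a)) (\<lambda>a. g' (f' a))"
      by (rule C.entails_reindex[of "carrier B"]) (use le closed in \<open>auto simp: ArrAlg_def\<close>)
  qed (use closed in auto)
  then show "Hle (ArrAlg \<U>) A C (Comp (ArrAlg \<U>) A B C g f) (Comp (ArrAlg \<U>) A B C g' f')"
    by (simp add: ArrAlg_def compose_def)
qed

section \<open>Implicative morphisms and cartesian transformations\<close>

text \<open>
  Binary meets are the one point that needs all of the structure: \<open>f\<close> preserves the entailment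
  \<open>\<phi> \<turnstile> \<psi> \<leadsto> \<phi> \<and> \<psi>\<close> and, up to a realizer, the implication on its right, so that
  \<open>f \<phi> \<turnstile> f \<psi> \<leadsto> f (\<phi> \<and> \<psi>)\<close>.
\<close>

lemma cartesian_arrow_transformation:
  assumes A: "arrow_algebra A" and B: "arrow_algebra B" and f: "implicative_morphism A B f"
  shows "cartesian_transformation \<U> (arrow_tripos A) (arrow_tripos B) (arrow_transformation \<U> A B f)"
proof -
  interpret A: arrow_algebra A by (rule A)
  interpret B: arrow_algebra B by (rule B)
  have fc: "f a \<in> carrier B" if "a \<in> carrier A" for a
    using f that by (auto simp: implicative_morphism_def)
  let ?P = "arrow_tripos A" and ?Q = "arrow_tripos B"
  let ?h = "\<lambda>X. \<lambda>\<phi>\<in>X \<rightarrow>\<^sub>E carrier A. compose X f \<phi>"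
  have mono: "monotone_map (fibre ?P X) (fibre ?Q X) (?h X)" for X
    unfolding monotone_map_def isotone_def
    using A.weak_partial_order_arrow_tripos B.weak_partial_order_arrow_tripos fc
    by (auto simp: PiE_iff compose_def intro!: implicative_morphism_entails[OF A B f])
  have meets: "preserves_finite_meets (fibre ?P X) (fibre ?Q X) (?h X)" for X
  proof (rule preserves_finite_meetsI[OF A.heyting_operations_arrow_tripos
        B.heyting_operations_arrow_tripos mono])
    have "f \<top>\<^bsub>A\<^esub> \<in> separator B"
      using f A.top_separator by (auto simp: implicative_morphism_def)
    then have "entails B X (\<lambda>_. \<top>\<^bsub>B\<^esub>) (\<lambda>_. f \<top>\<^bsub>A\<^esub>)"
      using B.separator_closed by (intro B.entails_of_valid B.valid_of_separator) auto
    then show "(\<lambda>i\<in>X. \<top>\<^bsub>B\<^esub>) \<sqsubseteq>\<^bsub>fibre ?Q X\<^esub> ?h X (\<lambda>i\<in>X. \<top>\<^bsub>A\<^esub>)"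
      by (simp add: compose_def cong: entails_cong)
    fix \<phi> \<psi> assume "\<phi> \<in> carrier (fibre ?P X)" "\<psi> \<in> carrier (fibre ?P X)"
    then have \<phi>: "\<phi> \<in> X \<rightarrow>\<^sub>E carrier A" and \<psi>: "\<psi> \<in> X \<rightarrow>\<^sub>E carrier A" by auto
    then have \<phi>c: "\<And>i. i \<in> X \<Longrightarrow> \<phi> i \<in> carrier A" and \<psi>c: "\<And>i. i \<in> X \<Longrightarrow> \<psi> i \<in> carrier A" by auto
    let ?c = "\<lambda>i. arrow_conj A (\<phi> i) (\<psi> i)"
    have "entails A X \<phi> (\<lambda>i. \<psi> i \<leadsto>\<^bsub>A\<^esub> ?c i)"
      using \<phi>c \<psi>c A.entails_refl[of ?c X] A.entails_curry[of \<phi> X \<psi> ?c] by auto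
    then have "entails B X (\<lambda>i. f (\<phi> i)) (\<lambda>i. f (\<psi> i \<leadsto>\<^bsub>A\<^esub> ?c i))"
      by (rule implicative_morphism_entails[OF A B f, rotated 2]) (use \<phi>c \<psi>c in auto)
    moreover have "entails B X (\<lambda>i. f (\<psi> i \<leadsto>\<^bsub>A\<^esub> ?c i)) (\<lambda>i. f (\<psi> i) \<leadsto>\<^bsub>B\<^esub> f (?c i))"
      using B.entails_reindex[of "carrier A \<times> carrier A" "\<lambda>p. f (fst p \<leadsto>\<^bsub>A\<^esub> snd p)"
          "\<lambda>p. f (fst p) \<leadsto>\<^bsub>B\<^esub> f (snd p)" "\<lambda>i. (\<psi> i, ?c i)" X] f fc \<phi>c \<psi>c
      by (auto simp: implicative_morphism_iff[OF A B])
    ultimately have "entails B X (\<lambda>i. f (\<phi> i)) (\<lambda>i. f (\<psi> i) \<leadsto>\<^bsub>B\<^esub> f (?c i))"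
      by (rule B.entails_trans) (use \<phi>c \<psi>c fc in auto)
    then have "entails B X (\<lambda>i. arrow_conj B (f (\<phi> i)) (f (\<psi> i))) (\<lambda>i. f (?c i))"
      by (subst B.entails_curry) (use \<phi>c \<psi>c fc in auto)
    then show "(\<lambda>i\<in>X. arrow_conj B (?h X \<phi> i) (?h X \<psi> i)) \<sqsubseteq>\<^bsub>fibre ?Q X\<^esub> ?h X (\<lambda>i\<in>X. ?c i)"
      using \<phi> \<psi> \<phi>c \<psi>c by (simp add: compose_def cong: entails_cong)
  qed
  have "?h X (reindex ?P X Y g \<phi>) .=\<^bsub>fibre ?Q X\<^esub> reindex ?Q X Y g (?h Y \<phi>)"
    if "g \<in> X \<rightarrow>\<^sub>E Y" "\<phi> \<in> carrier (fibre ?P Y)" for X Y g \<phi>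
    using that fc by (auto simp: compose_def PiE_iff intro!: B.entails_le)
  then show ?thesis
    unfolding cartesian_transformation_def transformation_def arrow_transformation_def
    using mono meets by (simp del: arrow_tripos_simps(2,3,4))
qed

text \<open>
  A cartesian transformation between arrow triposes, from which an implicative morphism is to be
  recovered as the value at the generic element.
\<close>

locale arrow_tripos_cartesian =
  universe: set_universe \<U> + A: arrow_algebra A + B: arrow_algebra B
  for \<U> :: "'u set set" and A B :: "'u arrow_structure" +
  fixes \<Phi> :: "'u set \<Rightarrow> ('u \<Rightarrow> 'u) \<Rightarrow> 'u \<Rightarrow> 'u"
  assumes small: "carrier A \<in> \<U>"
    and cartesian: "cartesian_transformation \<U> (arrow_tripos A) (arrow_tripos B) \<Phi>"
begin

definition underlying :: "'u \<Rightarrow> 'u" where "underlying = \<Phi> (carrier A) (\<lambda>a\<in>carrier A. a)"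

lemma component_closed: "\<lbrakk>X \<in> \<U>; \<phi> \<in> X \<rightarrow>\<^sub>E carrier A\<rbrakk> \<Longrightarrow> \<Phi> X \<phi> \<in> X \<rightarrow>\<^sub>E carrier B"
  using cartesian by (auto simp: cartesian_transformation_def transformation_def monotone_map_def)

lemma component_mono:
  "\<lbrakk>X \<in> \<U>; \<phi> \<in> X \<rightarrow>\<^sub>E carrier A; \<psi> \<in> X \<rightarrow>\<^sub>E carrier A; entails A X \<phi> \<psi>\<rbrakk> \<Longrightarrow> entails B X (\<Phi> X \<phi>) (\<Phi> X \<psi>)"
  using cartesian
  by (auto simp: cartesian_transformation_def transformation_def monotone_map_def isotone_def)

lemma underlying_closed: "underlying \<in> carrier A \<rightarrow>\<^sub>E carrier B"
  unfolding underlying_def using small by (intro component_closed) auto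

text \<open>
  Naturality along \<open>\<phi> : X \<rightarrow> A\<close> itself, at the identity of the carrier.
\<close>

lemma component_equiv:
  assumes "X \<in> \<U>" "\<phi> \<in> X \<rightarrow>\<^sub>E carrier A"
  shows "entails B X (\<Phi> X \<phi>) (\<lambda>x. underlying (\<phi> x))" "entails B X (\<lambda>x. underlying (\<phi> x)) (\<Phi> X \<phi>)"
proof -
  let ?i = "\<lambda>a\<in>carrier A. a"
  have "compose X ?i \<phi> = \<phi>"
    using assms by (auto simp: PiE_def intro!: Id_compose)
  moreover have "\<Phi> X (reindex (arrow_tripos A) X (carrier A) \<phi> ?i) .=\<^bsub>fibre (arrow_tripos B) X\<^esub>
      reindex (arrow_tripos B) X (carrier A) \<phi> (\<Phi> (carrier A) ?i)"
    using cartesian assms small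
    by (auto simp: cartesian_transformation_def transformation_def simp del: arrow_tripos_simps(2,3,4))
  ultimately show "entails B X (\<Phi> X \<phi>) (\<lambda>x. underlying (\<phi> x))" "entails B X (\<lambda>x. underlying (\<phi> x)) (\<Phi> X \<phi>)"
    by (simp_all add: underlying_def compose_def)
qed

lemma underlying_entails:
  assumes X: "X \<in> \<U>" and "\<phi> \<in> X \<rightarrow>\<^sub>E carrier A" "\<psi> \<in> X \<rightarrow>\<^sub>E carrier A" "entails A X \<phi> \<psi>"
  shows "entails B X (\<lambda>x. underlying (\<phi> x)) (\<lambda>x. underlying (\<psi> x))"
proof -
  have "entails B X (\<lambda>x. underlying (\<phi> x)) (\<Phi> X \<psi>)"
    by (rule B.entails_trans[OF component_equiv(2) component_mono])
      (use assms component_closed[OF X] underlying_closed in \<open>auto simp: PiE_iff\<close>)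
  then show ?thesis
    by (rule B.entails_trans[OF _ component_equiv(1)])
      (use assms component_closed[OF X] underlying_closed in \<open>auto simp: PiE_iff\<close>)
qed

text \<open>
  The chosen conjunction is a meet in the fibre over \<open>X\<close>, so \<open>\<Phi>\<close> sends it to a meet; the values of
  \<open>\<Phi>\<close> are then exchanged for those of the underlying map by \<open>component_equiv\<close>.
\<close>

lemma underlying_conj:
  assumes X: "X \<in> \<U>" and \<phi>: "\<phi> \<in> X \<rightarrow>\<^sub>E carrier A" and \<psi>: "\<psi> \<in> X \<rightarrow>\<^sub>E carrier A"
  shows "entails B X (\<lambda>x. arrow_conj B (underlying (\<phi> x)) (underlying (\<psi> x))) (\<lambda>x. underlying (arrow_conj A (\<phi> x) (\<psi> x)))"
proof -
  interpret LA: heyting_operations "fibre (arrow_tripos A) X" "\<lambda>i\<in>X. \<top>\<^bsub>A\<^esub>" "\<lambda>i\<in>X. \<bottom>\<^bsub>A\<^esub>"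
     "\<lambda>\<phi> \<psi>. \<lambda>i\<in>X. arrow_conj A (\<phi> i) (\<psi> i)" "\<lambda>\<phi> \<psi>. \<lambda>i\<in>X. arrow_disj A (\<phi> i) (\<psi> i)"
     "\<lambda>\<phi> \<psi>. \<lambda>i\<in>X. \<phi> i \<leadsto>\<^bsub>A\<^esub> \<psi> i"
    by (rule A.heyting_operations_arrow_tripos)
  let ?c = "\<lambda>x\<in>X. arrow_conj A (\<phi> x) (\<psi> x)"
  let ?d = "\<lambda>x\<in>X. arrow_conj B (underlying (\<phi> x)) (underlying (\<psi> x))"
  have \<phi>\<psi>c: "\<phi> x \<in> carrier A" "\<psi> x \<in> carrier A" "underlying (\<phi> x) \<in> carrier B" "underlying (\<psi> x) \<in> carrier B"
    if "x \<in> X" for x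
    using that \<phi> \<psi> underlying_closed by auto
  have c: "?c \<in> X \<rightarrow>\<^sub>E carrier A" using \<phi>\<psi>c by auto
  have "greatest (fibre (arrow_tripos A) X) ?c (Lower (fibre (arrow_tripos A) X) {\<phi>, \<psi>})"
    using \<phi> \<psi> LA.conj_le1 LA.conj_le2 LA.le_conj c by (subst greatest_Lower_iff) auto
  moreover have "finite {\<phi>, \<psi>}" "{\<phi>, \<psi>} \<subseteq> carrier (fibre (arrow_tripos A) X)"
    using \<phi> \<psi> by auto
  ultimately have "greatest (fibre (arrow_tripos B) X) (\<Phi> X ?c)
      (Lower (fibre (arrow_tripos B) X) (\<Phi> X ` {\<phi>, \<psi>}))"
    using cartesian X unfolding cartesian_transformation_def preserves_finite_meets_def by blast
  then have glb: "entails B X z (\<Phi> X ?c)"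
    if "z \<in> X \<rightarrow>\<^sub>E carrier B" "entails B X z (\<Phi> X \<phi>)" "entails B X z (\<Phi> X \<psi>)" for z
    using that component_closed[OF X \<phi>] component_closed[OF X \<psi>] by (subst (asm) greatest_Lower_iff) auto
  have "entails B X ?d (\<Phi> X ?c)"
  proof (rule glb)
    show "entails B X ?d (\<Phi> X \<phi>)"
      unfolding entails_restrict
      by (rule B.entails_trans[OF B.entails_conj1 component_equiv(2)])
        (use X \<phi> \<phi>\<psi>c component_closed[OF X \<phi>] in \<open>auto simp: PiE_iff\<close>)
    show "entails B X ?d (\<Phi> X \<psi>)"
      unfolding entails_restrict
      by (rule B.entails_trans[OF B.entails_conj2 component_equiv(2)])
        (use X \<psi> \<phi>\<psi>c component_closed[OF X \<psi>] in \<open>auto simp: PiE_iff\<close>)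
  qed (use \<phi>\<psi>c in auto)
  then have "entails B X ?d (\<lambda>x. underlying (?c x))"
    by (rule B.entails_trans[OF _ component_equiv(1)])
      (use X c \<phi>\<psi>c component_closed[OF X c] underlying_closed in \<open>auto simp: PiE_iff\<close>)
  then show ?thesis by (simp cong: entails_cong)
qed

text \<open>
  Over a one-point set, a constant in the separator is a top element of the fibre, that is, a meet
  of the empty set.  The carrier supplies such a set, being small and containing \<open>\<top>\<close>.
\<close>

lemma underlying_separator:
  assumes a: "a \<in> separator A"
  shows "underlying a \<in> separator B"
proof -
  let ?X = "{\<top>\<^bsub>A\<^esub>}" and ?\<phi> = "\<lambda>x\<in>{\<top>\<^bsub>A\<^esub>}. a"
  have X: "?X \<in> \<U>" by (rule universe.subset_closed[OF small]) simp
  have ac: "a \<in> carrier A" "underlying a \<in> carrier B" using a A.separator_closed underlying_closed by auto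
  then have \<phi>: "?\<phi> \<in> ?X \<rightarrow>\<^sub>E carrier A" by auto
  have "entails A ?X \<psi> ?\<phi>" if "\<psi> \<in> ?X \<rightarrow>\<^sub>E carrier A" for \<psi>
    using that a ac unfolding entails_restrict
    by (intro A.entails_of_valid A.valid_of_separator[of a]) (auto simp: PiE_iff)
  then have "greatest (fibre (arrow_tripos A) ?X) ?\<phi> (Lower (fibre (arrow_tripos A) ?X) {})"
    using \<phi> by (subst greatest_Lower_iff) auto
  then have "greatest (fibre (arrow_tripos B) ?X) (\<Phi> ?X ?\<phi>) (Lower (fibre (arrow_tripos B) ?X) {})"
    using cartesian X unfolding cartesian_transformation_def preserves_finite_meets_def
    by (metis empty_subsetI finite.emptyI image_empty)
  then have "\<forall>z\<in>?X \<rightarrow>\<^sub>E carrier B. entails B ?X z (\<Phi> ?X ?\<phi>)"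
    by (subst (asm) greatest_Lower_iff) auto
  then have "entails B ?X (\<lambda>x\<in>?X. \<top>\<^bsub>B\<^esub>) (\<Phi> ?X ?\<phi>)"
    by (rule bspec) auto
  then have "entails B ?X (\<lambda>x. \<top>\<^bsub>B\<^esub>) (\<lambda>x. underlying (?\<phi> x))"
    unfolding entails_restrict
    by (rule B.entails_trans[OF _ component_equiv(1)[OF X \<phi>]])
      (use ac component_closed[OF X \<phi>] in \<open>auto simp: PiE_iff\<close>)
  then have "\<top>\<^bsub>B\<^esub> \<leadsto>\<^bsub>B\<^esub> underlying a \<in> separator B"
    using ac by (simp add: entails_eq_valid valid_def)
  then show ?thesis
    using ac by (auto intro: B.modus_ponens[of "\<top>\<^bsub>B\<^esub>"] B.top_separator)
qed

text \<open>
  Sets of pairs need not themselves be small sets, but they can be enumerated by one, since small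
  sets are closed under products up to bijection and under subsets.
\<close>

lemma small_pairs:
  assumes "Y \<subseteq> carrier A \<times> carrier A"
  obtains X k where "X \<in> \<U>" "Y = k ` X"
proof -
  obtain Z h where Z: "Z \<in> \<U>" and h: "bij_betw h (carrier A \<times> carrier A) Z"
    using universe.times_closed[OF small small] by blast
  have "h ` Y \<in> \<U>"
    using universe.subset_closed[OF Z, of "h ` Y"] h assms by (auto simp: bij_betw_def)
  moreover have "Y = inv_into (carrier A \<times> carrier A) h ` h ` Y"
    using h assms by (simp add: bij_betw_def)
  ultimately show ?thesis by (rule that)
qed

text \<open>
  The third condition is monotonicity of \<open>\<Phi>\<close> over a small enumeration of the given set of pairs.
  The second is the entailment \<open>(a \<leadsto> a') \<and> a \<turnstile> a'\<close> over all pairs, whose left side \<open>\<Phi>\<close> preserves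
  because it preserves meets.
\<close>

lemma implicative_morphism_underlying: "implicative_morphism A B underlying"
  unfolding implicative_morphism_iff[OF A.arrow_algebra_axioms B.arrow_algebra_axioms]
proof (intro conjI ballI allI impI)
  have fc: "underlying a \<in> carrier B" if "a \<in> carrier A" for a using underlying_closed that by auto
  show "underlying \<in> carrier A \<rightarrow> carrier B" using fc by auto
  show "underlying a \<in> separator B" if "a \<in> separator A" for a by (rule underlying_separator[OF that])
  {
    fix Y assume Y: "Y \<subseteq> carrier A \<times> carrier A" "entails A Y fst snd"
    obtain X k where X: "X \<in> \<U>" "Y = k ` X" by (rule small_pairs[OF Y(1)])
    have "k x \<in> carrier A \<times> carrier A" if "x \<in> X" for x using X(2) Y(1) that by blast
    then have "(\<lambda>x\<in>X. fst (k x)) \<in> X \<rightarrow>\<^sub>E carrier A" "(\<lambda>x\<in>X. snd (k x)) \<in> X \<rightarrow>\<^sub>E carrier A"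
      by (simp_all add: mem_Times_iff)
    moreover have "entails A X (\<lambda>x\<in>X. fst (k x)) (\<lambda>x\<in>X. snd (k x))"
      using X(2) Y(2) by (simp add: entails_image)
    ultimately have "entails B X (\<lambda>x. underlying ((\<lambda>x\<in>X. fst (k x)) x)) (\<lambda>x. underlying ((\<lambda>x\<in>X. snd (k x)) x))"
      by (rule underlying_entails[OF X(1)])
    then show "entails B Y (\<lambda>p. underlying (fst p)) (\<lambda>p. underlying (snd p))"
      unfolding X(2) entails_image by (simp cong: entails_cong)
  }
  obtain X k where X: "X \<in> \<U>" "carrier A \<times> carrier A = k ` X" by (rule small_pairs[OF subset_refl])
  have kc: "fst (k x) \<in> carrier A" "snd (k x) \<in> carrier A" if "x \<in> X" for x
    using X(2) that by (metis imageI mem_Times_iff)+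
  let ?i = "\<lambda>x\<in>X. fst (k x) \<leadsto>\<^bsub>A\<^esub> snd (k x)" and ?a = "\<lambda>x\<in>X. fst (k x)" and ?b = "\<lambda>x\<in>X. snd (k x)"
  let ?c = "\<lambda>x\<in>X. arrow_conj A (?i x) (?a x)"
  have mem: "?i \<in> X \<rightarrow>\<^sub>E carrier A" "?a \<in> X \<rightarrow>\<^sub>E carrier A" "?b \<in> X \<rightarrow>\<^sub>E carrier A"
    using kc by auto
  then have c: "?c \<in> X \<rightarrow>\<^sub>E carrier A" by auto
  have "entails A X ?c ?b"
    unfolding entails_restrict using mem kc
    by (subst A.entails_curry) (auto intro!: A.entails_le)
  then have eval: "entails B X (\<lambda>x. underlying (?c x)) (\<lambda>x. underlying (?b x))"
    by (rule underlying_entails[OF X(1) c mem(3)])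
  have "entails B X (\<lambda>x. arrow_conj B (underlying (?i x)) (underlying (?a x))) (\<lambda>x. underlying (?c x))"
    using underlying_conj[OF X(1) mem(1,2)] by (simp cong: entails_cong)
  then have "entails B X (\<lambda>x. arrow_conj B (underlying (?i x)) (underlying (?a x))) (\<lambda>x. underlying (?b x))"
    by (rule B.entails_trans[OF _ eval]) (use kc fc in auto)
  then have "entails B X (\<lambda>x. underlying (?i x)) (\<lambda>x. underlying (?a x) \<leadsto>\<^bsub>B\<^esub> underlying (?b x))"
    by (subst (asm) B.entails_curry) (use kc fc in auto)
  then show "entails B (carrier A \<times> carrier A) (\<lambda>p. underlying (fst p \<leadsto>\<^bsub>A\<^esub> snd p)) (\<lambda>p. underlying (fst p) \<leadsto>\<^bsub>B\<^esub> underlying (snd p))"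
    unfolding X(2) entails_image by (simp cong: entails_cong)
qed

end

lemma preorder_equivalence_arrow_transformation:
  assumes U: "set_universe \<U>" and A: "A \<in> Ob (ArrAlg \<U>)" and B: "B \<in> Ob (ArrAlg \<U>)"
  shows "preorder_equivalence (Hom (ArrAlg \<U>) A B) (Hle (ArrAlg \<U>) A B)
     (Hom (Trip_cart \<U>) (arrow_tripos A) (arrow_tripos B))
     (Hle (Trip_cart \<U>) (arrow_tripos A) (arrow_tripos B)) (arrow_transformation \<U> A B)"
  unfolding preorder_equivalence_def
proof (intro conjI ballI impI)
  have aA: "arrow_algebra A" and aB: "arrow_algebra B" and small: "carrier A \<in> \<U>"
    using A B by (auto simp: ArrAlg_def)
  interpret B: arrow_algebra B by (rule aB)
  let ?T = "arrow_transformation \<U> A B" and ?D = "Hle (Trip_cart \<U>) (arrow_tripos A) (arrow_tripos B)"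
  have le: "?D \<Phi> \<Psi> \<longleftrightarrow> (\<forall>X\<in>\<U>. \<forall>\<phi>\<in>X \<rightarrow>\<^sub>E carrier A. entails B X (\<Phi> X \<phi>) (\<Psi> X \<phi>))" for \<Phi> \<Psi>
    by (simp add: Trip_cart_def)
  have T: "entails B X (?T f X \<phi>) \<psi> \<longleftrightarrow> entails B X (\<lambda>x. f (\<phi> x)) \<psi>"
    "entails B X \<psi> (?T f X \<phi>) \<longleftrightarrow> entails B X \<psi> (\<lambda>x. f (\<phi> x))"
    if "X \<in> \<U>" "\<phi> \<in> X \<rightarrow>\<^sub>E carrier A" for X f \<phi> \<psi>
    using that by (simp_all add: arrow_transformation_def compose_def)
  show "?T \<in> Hom (ArrAlg \<U>) A B \<rightarrow> Hom (Trip_cart \<U>) (arrow_tripos A) (arrow_tripos B)"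
  proof (intro Pi_I)
    fix f assume f: "f \<in> Hom (ArrAlg \<U>) A B"
    then have "cartesian_transformation \<U> (arrow_tripos A) (arrow_tripos B) (?T f)"
      by (intro cartesian_arrow_transformation[OF aA aB]) (simp add: ArrAlg_def)
    moreover have "?T f \<in> (\<Pi>\<^sub>E X\<in>\<U>. (X \<rightarrow>\<^sub>E carrier A) \<rightarrow>\<^sub>E (X \<rightarrow>\<^sub>E carrier B))"
      using f by (auto simp: ArrAlg_def arrow_transformation_def compose_def PiE_iff)
    ultimately show "?T f \<in> Hom (Trip_cart \<U>) (arrow_tripos A) (arrow_tripos B)"
      by (simp add: Trip_cart_def)
  qed
  {
    fix f g assume fg: "f \<in> Hom (ArrAlg \<U>) A B" "g \<in> Hom (ArrAlg \<U>) A B"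
    then have c: "f \<in> carrier A \<rightarrow> carrier B" "g \<in> carrier A \<rightarrow> carrier B"
      by (auto simp: ArrAlg_def PiE_iff)
    show "?D (?T f) (?T g)" if "Hle (ArrAlg \<U>) A B f g"
      using that B.entails_reindex[OF _ _ c] by (auto simp: le T ArrAlg_def PiE_iff)
    show "Hle (ArrAlg \<U>) A B f g" if "?D (?T f) (?T g)"
    proof -
      have "entails B (carrier A) (?T f (carrier A) (\<lambda>a\<in>carrier A. a)) (?T g (carrier A) (\<lambda>a\<in>carrier A. a))"
        using that small unfolding le by auto
      then show ?thesis
        using small by (simp add: T ArrAlg_def cong: entails_cong)
    qed
  }
  fix \<Phi> assume \<Phi>: "\<Phi> \<in> Hom (Trip_cart \<U>) (arrow_tripos A) (arrow_tripos B)"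
  interpret U: set_universe \<U> by (rule U)
  interpret arrow_tripos_cartesian \<U> A B \<Phi>
    by (intro arrow_tripos_cartesian.intro arrow_tripos_cartesian_axioms.intro U aA aB small)
      (use \<Phi> in \<open>simp add: Trip_cart_def\<close>)
  show "\<exists>f\<in>Hom (ArrAlg \<U>) A B. ?D (?T f) \<Phi> \<and> ?D \<Phi> (?T f)"
  proof
    show "underlying \<in> Hom (ArrAlg \<U>) A B"
      using implicative_morphism_underlying underlying_closed by (simp add: ArrAlg_def)
    show "?D (?T underlying) \<Phi> \<and> ?D \<Phi> (?T underlying)"
      using component_equiv by (simp add: le T)
  qed
qed

theorem proposition5p4:
  fixes \<U> :: "'u set set"
  assumes "set_universe \<U>"
  shows "two_fully_faithful_functor (ArrAlg \<U>) (Trip_cart \<U>)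
           arrow_tripos (arrow_transformation \<U>) \<and>
         (\<forall>A B. arrow_algebra A \<and> carrier A \<in> \<U> \<and> arrow_algebra B \<and> carrier B \<in> \<U> \<longrightarrow>
           preorder_equivalence
             (Hom (ArrAlg \<U>) A B)
             (Hle (ArrAlg \<U>) A B)
             (Hom (Trip_cart \<U>) (arrow_tripos A) (arrow_tripos B))
             (Hle (Trip_cart \<U>) (arrow_tripos A) (arrow_tripos B))
             (arrow_transformation \<U> A B))"
proof
  note equivalence = preorder_equivalence_arrow_transformation[OF assms]
  show "two_fully_faithful_functor (ArrAlg \<U>) (Trip_cart \<U>) arrow_tripos (arrow_transformation \<U>)"
  proof (intro two_fully_faithful_functor.intro two_functor.intro
      preorder_enriched_category_ArrAlg preorder_enriched_category_Trip_cart)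
    show "two_functor_axioms (ArrAlg \<U>) (Trip_cart \<U>) arrow_tripos (arrow_transformation \<U>)"
    proof
      fix A B assume AB: "A \<in> Ob (ArrAlg \<U>)" "B \<in> Ob (ArrAlg \<U>)"
      show "arrow_tripos A \<in> Ob (Trip_cart \<U>)"
        using AB arrow_algebra.tripos_arrow_tripos by (auto simp: Trip_cart_def ArrAlg_def)
      show "arrow_transformation \<U> A A (Idm (ArrAlg \<U>) A) = Idm (Trip_cart \<U>) (arrow_tripos A)"
        by (auto simp: arrow_transformation_def ArrAlg_def Trip_cart_def PiE_def
            intro!: restrict_ext Id_compose)
      show "arrow_transformation \<U> A B f \<in> Hom (Trip_cart \<U>) (arrow_tripos A) (arrow_tripos B)"
        if "f \<in> Hom (ArrAlg \<U>) A B" for f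
        using equivalence[OF AB] that by (auto simp: preorder_equivalence_def)
      show "Hle (Trip_cart \<U>) (arrow_tripos A) (arrow_tripos B)
          (arrow_transformation \<U> A B f) (arrow_transformation \<U> A B g)"
        if "f \<in> Hom (ArrAlg \<U>) A B" "g \<in> Hom (ArrAlg \<U>) A B" "Hle (ArrAlg \<U>) A B f g" for f g
        using equivalence[OF AB] that by (auto simp: preorder_equivalence_def)
      fix C f g assume "f \<in> Hom (ArrAlg \<U>) A B" "g \<in> Hom (ArrAlg \<U>) B C"
      then have "f \<in> carrier A \<rightarrow> carrier B" by (auto simp: ArrAlg_def PiE_iff)
      then have "restrict (compose X (compose (carrier A) g f)) (X \<rightarrow>\<^sub>E carrier A) =
          compose (X \<rightarrow>\<^sub>E carrier A) (restrict (compose X g) (X \<rightarrow>\<^sub>E carrier B))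
            (restrict (compose X f) (X \<rightarrow>\<^sub>E carrier A))" for X :: "'u set"
        by (auto simp: fun_eq_iff compose_def PiE_iff)
      then show "arrow_transformation \<U> A C (Comp (ArrAlg \<U>) A B C g f) =
          Comp (Trip_cart \<U>) (arrow_tripos A) (arrow_tripos B) (arrow_tripos C)
            (arrow_transformation \<U> B C g) (arrow_transformation \<U> A B f)"
        by (simp add: arrow_transformation_def ArrAlg_def Trip_cart_def cong: restrict_cong)
    qed
    show "two_fully_faithful_functor_axioms (ArrAlg \<U>) (Trip_cart \<U>) arrow_tripos (arrow_transformation \<U>)"
      using equivalence by unfold_locales
  qed
  show "\<forall>A B. arrow_algebra A \<and> carrier A \<in> \<U> \<and> arrow_algebra B \<and> carrier B \<in> \<U> \<longrightarrow>
      preorder_equivalence (Hom (ArrAlg \<U>) A B) (Hle (ArrAlg \<U>) A B)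
        (Hom (Trip_cart \<U>) (arrow_tripos A) (arrow_tripos B))
        (Hle (Trip_cart \<U>) (arrow_tripos A) (arrow_tripos B)) (arrow_transformation \<U> A B)"
    using equivalence by (simp add: ArrAlg_def)
qed

end
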